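(* Let $\mathbb F$ be an infinite field, $\Gamma$ an ordered abelian group, and let $\nu\colon\mathbb F[[t^\Gamma]]\to F[\Gamma]$ be an enriched valuation equal to either the valuation $\operatorname{val}$ (with $F=\mathbb K$), the signed valuation $\operatorname{sval}$ (with $F=\mathbb S$, where $\mathbb F$ is an ordered field), or the fine valuation $\operatorname{fval}$ (with $F=\mathbb F$). Then for any $\mathbb F[[t^\Gamma]]$-matroid $N$, we have $$\nu(\mathcal V^*(N))=\mathcal V^*(\nu_*(N)).$$
   Context: Tracts. A tract $F=(F^\times,N_F)$ is a multiplicative abelian group $F^\times$ (identity $1$) together with a subset $N_F$ (the null set) of the group semiring $\mathbb N[F^\times]$ of finite formal sums such that: $0\in N_F$; $1\notin N_F$; there is a unique element $-1$ with $1+(-1)\in N_F$; and if $\sum a_i\in N_F$ then $\sum c\,a_i\in N_F$ for all $c\in F^\times$. We also write $F=F^\times\cup\{0\}$ with $0\cdot g=0$; zero terms of formal sums are dropped. A homomorphism of tracts is a group homomorphism $F_1^\times\to F_2^\times$ whose induced map on formal sums sends $N_{F_1}$ into $N_{F_2}$ (extended by $0\mapsto0$). A field is a tract whose null set consists of the formal sums of nonzero elements that add to zero. The Krasner hyperfield $\mathbb K$ has $\mathbb K^\times=\{1\}$ and $N_{\mathbb K}=\{k\cdot1:k\ge2\}\cup\{0\}$. The sign hyperfield $\mathbb S$ has $\mathbb S^\times=\{1,-1\}$ and $N_{\mathbb S}=\{k\cdot1+\ell\cdot(-1):k,\ell\ge1\}\cup\{0\}$. Every tract comes with some fixed involution $a\mapsto\overline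 a$ (a tract homomorphism from the tract to itself squaring to the identity). Tropical extension. $\Gamma$ is written additively. $F[\Gamma]$ is the tract with group $F^\times\times\Gamma$, zero element $\infty$, and null set consisting of the zero element and all finite sums $\sum_{i\in I}(a_i,\gamma_i)$ with $\sum_{i\in I_{\min}}a_i\in N_F$, where $I_{\min}=\{i\in I:\gamma_i\le\gamma_j\ \forall j\in I\}$. Enriched valuations. An enriched valuation on a field is a surjective tract homomorphism from it to a tropical extension $F[\Gamma]$. $\mathbb F[[t^\Gamma]]$ is the field of Hahn series $\sum_{g\in G}c_gt^g$ with $c_g\in\mathbb F^\times$ and $G\subseteq\Gamma$ well-ordered, along with zero. For a nonzero series let $\gamma=\min G$. Then $\operatorname{val}$ sends it to $\gamma$, identified with $(1,\gamma)\in\mathbb K[\Gamma]$; $\operatorname{sval}$ (for $\mathbb F$ ordered) sends it to $(\operatorname{sgn}(c_\gamma),\gamma)\in\mathbb S[\Gamma]$, where $\operatorname{sgn}$ sends positive elements to $1$ and negative elements to $-1$; $\operatorname{fval}$ sends it to $(c_\gamma,\gamma)\in\mathbb F[\Gamma]$. All send $0$ to $\infty$. They are applied to tuples coordinatewise. Matroids. Let $E$ be a finite totally ordered set and $1\le r\le|E|$. For a tract $F$, a (strong) Plücker vector of rank $r$ on $E$ is a nonzero function $P\colon\binom Er\to F$ with $\sum_{j\in J\setminus I}\operatorname{sign}(j;I,J)P(I+j)P(J-j)\in N_F$ for all $I\in\binom{E}{r-1}$, $J\in\binom{E}{r+1}$, where $\operatorname{sign}(j;I,J)=(-1)^\ell$,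 $\ell=\#\{j'\in J:j<j'\}+\#\{i\in I:j<i\}$. An $F$-matroid is an equivalence class of Plücker vectors under scaling by $F^\times$. For $\tau=\{i_0<\dots<i_r\}$ let $(C_\tau)_{i_s}=(-1)^sP(\tau-i_s)$, and $0$ elsewhere; the circuits $\mathcal C(M)\subseteq F^E$ are the $F^\times$-multiples of the nonzero $C_\tau$. The covectors $\mathcal V^*(M)$ are the tuples $Y\in F^E$ with $\sum_{i\in E}C_i\overline{Y_i}\in N_F$ for all $C\in\mathcal C(M)$. For a tract homomorphism $f\colon F_1\to F_2$ and an $F_1$-matroid $M$ with Plücker vector $P$, the push-forward $f_*(M)$ is the $F_2$-matroid with Plücker vector $I\mapsto f(P(I))$.
   Formalization: The fixed involutions of the Hahn series field and of F[Γ] are assumed compatible with ν, i.e. ν of the conjugate of x is the conjugate of ν(x); without this the equality fails (fval over the complex numbers, identity versus conjugation, P=(1,i)). *)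

theory Defs
  imports Complex_Main "HOL-Algebra.Group" "HOL-Library.Multiset" "HOL-Library.Ramsey"
begin

section \<open>Well-ordered subsets of an ordered abelian group\<close>

lemma wfp_on_Un_less:
  assumes "wfp_on A (<)" "wfp_on B ((<) :: 'a::linorder \<Rightarrow> _)"
  shows "wfp_on (A \<union> B) (<)"
  unfolding wfp_on_iff_ex_minimal
proof (intro allI impI)
  fix C assume C: "C \<subseteq> A \<union> B" "C \<noteq> {}"
  have mA: "\<exists>z\<in>D. \<forall>y. y < z \<longrightarrow> y \<notin> D" if "D \<subseteq> A" "D \<noteq> {}" for D
    using assms(1) that unfolding wfp_on_iff_ex_minimal by blast
  have mB: "\<exists>z\<in>D. \<forall>y. y < z \<longrightarrow> y \<notin> D" if "D \<subseteq> B" "D \<noteq> {}" for D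
    using assms(2) that unfolding wfp_on_iff_ex_minimal by blast
  show "\<exists>z\<in>C. \<forall>y. y < z \<longrightarrow> y \<notin> C"
  proof (cases "C \<inter> A = {} \<or> C \<inter> B = {}")
    case True
    then have "C \<subseteq> B \<or> C \<subseteq> A" using C by blast
    then show ?thesis using mA[of C] mB[of C] C by blast
  next
    case False
    obtain a where a: "a \<in> C \<inter> A" "\<forall>y. y < a \<longrightarrow> y \<notin> C \<inter> A" using mA[of "C \<inter> A"] False by blast
    obtain b where b: "b \<in> C \<inter> B" "\<forall>y. y < b \<longrightarrow> y \<notin> C \<inter> B" using mB[of "C \<inter> B"] False by blast
    have "min a b \<in> C" using a b by (simp add: min_def)
    moreover have "\<forall>y. y < min a b \<longrightarrow> y \<notin> C" using a b C by auto
    ultimately show ?thesis by blast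
  qed
qed

lemma wfp_on_sumset:
  fixes A B :: "'g::linordered_ab_group_add set"
  assumes A: "wfp_on A (<)" and B: "wfp_on B (<)"
  shows "wfp_on {a + b |a b. a \<in> A \<and> b \<in> B} (<)"
  unfolding wfp_on_iff_ex_minimal
proof (intro allI impI, rule ccontr)
  fix C assume C: "C \<subseteq> {a + b |a b. a \<in> A \<and> b \<in> B}" "C \<noteq> {}"
    and no_min: "\<not> (\<exists>z\<in>C. \<forall>y. y < z \<longrightarrow> y \<notin> C)"
  have desc: "\<forall>c\<in>C. \<exists>d. d < c \<and> d \<in> C" using no_min by auto
  obtain f where f: "\<And>n::nat. f n \<in> C" and fd: "\<And>n. f (Suc n) < f n"
    proof -
    have "\<exists>f. \<forall>n::nat. f n \<in> C \<and> f (Suc n) < f n"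
      by (rule dependent_nat_choice) (use C(2) desc in auto)
    then show thesis using that by blast
  qed
  have fdec: "f n < f m" if "m < n" for m n
    using that
  proof (induction n)
    case (Suc n)
    then show ?case using fd[of n] by (cases "m = n") (auto intro: less_trans)
  qed simp
  have "\<forall>n. \<exists>a b. a \<in> A \<and> b \<in> B \<and> f n = a + b" using f C(1) by blast
  then obtain a b where ab: "\<And>n. a n \<in> A" "\<And>n. b n \<in> B" "\<And>n. f n = a n + b n" by metis
  obtain r where r: "strict_mono r" "monoseq (\<lambda>n. a (r n))" using seq_monosub[of a] by blast
  have "\<exists>m. \<forall>n n'. m \<le> n \<longrightarrow> n \<le> n' \<longrightarrow> a (r n) \<le> a (r n')"
  proof (cases "incseq (\<lambda>n. a (r n))")
    case True
    then show ?thesis by (auto simp: incseq_def)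
  next
    case False
    then have dec: "\<forall>m. \<forall>n\<ge>m. a (r n) \<le> a (r m)" using r(2) by (auto simp: monoseq_def incseq_def)
    have "range (\<lambda>n. a (r n)) \<subseteq> A" using ab by blast
    then have "\<exists>z\<in>range (\<lambda>n. a (r n)). \<forall>y. y < z \<longrightarrow> y \<notin> range (\<lambda>n. a (r n))"
      using A[unfolded wfp_on_iff_ex_minimal, rule_format] by blast
    then obtain m where "\<forall>y. y < a (r m) \<longrightarrow> y \<notin> range (\<lambda>n. a (r n))" by blast
    then have "\<forall>n. a (r m) \<le> a (r n)" by (meson linorder_not_less rangeI)
    then show ?thesis using dec by (meson order_trans)
  qed
  then obtain m where m: "\<And>n n'. m \<le> n \<Longrightarrow> n \<le> n' \<Longrightarrow> a (r n) \<le> a (r n')" by blast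
  have bd: "b (r (Suc n)) < b (r n)" if "m \<le> n" for n
  proof -
    have "f (r (Suc n)) < f (r n)" using r(1) by (intro fdec) (simp add: strict_mono_def)
    moreover have "a (r n) \<le> a (r (Suc n))" using m[of n "Suc n"] that by simp
    ultimately show ?thesis
      using add_mono[of "a (r n)" "a (r (Suc n))" "b (r n)" "b (r (Suc n))"] ab(3)[of "r n"] ab(3)[of "r (Suc n)"]
      by (auto simp: not_less[symmetric])
  qed
  have "(\<lambda>n. b (r n)) ` {m..} \<subseteq> B" "(\<lambda>n. b (r n)) ` {m..} \<noteq> {}" using ab by auto
  then have "\<exists>z\<in>(\<lambda>n. b (r n)) ` {m..}. \<forall>y. y < z \<longrightarrow> y \<notin> (\<lambda>n. b (r n)) ` {m..}"
    using B[unfolded wfp_on_iff_ex_minimal, rule_format] by blast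
  then obtain n where "n \<ge> m" "\<forall>y. y < b (r n) \<longrightarrow> y \<notin> (\<lambda>n. b (r n)) ` {m..}" by auto
  then show False using bd[of n] by force
qed

lemma finite_if_wfp_on_both:
  fixes A :: "'a::linorder set"
  assumes "wfp_on A (<)" "wfp_on A (>)"
  shows "finite A"
proof (rule ccontr)
  assume inf: "infinite A"
  have min: "\<exists>z\<in>D. \<forall>y\<in>D. z \<le> y" if "D \<subseteq> A" "D \<noteq> {}" for D
    using assms(1) that unfolding wfp_on_iff_ex_minimal by (meson not_less)
  have max: "\<exists>z\<in>D. \<forall>y\<in>D. y \<le> z" if "D \<subseteq> A" "D \<noteq> {}" for D
    using assms(2) that unfolding wfp_on_iff_ex_minimal by (meson not_less)
  define D where "D = {a \<in> A. finite {b \<in> A. b \<le> a}}"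
  obtain a0 where a0: "a0 \<in> A" "\<forall>y\<in>A. a0 \<le> y" using min[of A] inf by auto
  then have "{b \<in> A. b \<le> a0} \<subseteq> {a0}" by auto
  then have "a0 \<in> D" unfolding D_def using a0 finite_subset by blast
  then obtain m where m: "m \<in> D" "\<forall>y\<in>D. y \<le> m" using max[of D] D_def by blast
  then have "D \<subseteq> {b \<in> A. b \<le> m}" by (auto simp: D_def)
  moreover have fm: "finite {b \<in> A. b \<le> m}" using m by (simp add: D_def)
  ultimately have "A - D \<noteq> {}" using inf finite_subset by (metis Diff_eq_empty_iff)
  then obtain n where n: "n \<in> A - D" "\<forall>y\<in>A - D. n \<le> y" using min[of "A - D"] by blast
  have "{b \<in> A. b \<le> n} \<subseteq> insert n {b \<in> A. b \<le> m}"
    using n m by (auto simp: not_le) (metis DiffI leD le_less)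
  then have "finite {b \<in> A. b \<le> n}" using fm finite_subset by blast
  then show False using n by (simp add: D_def)
qed

lemma finite_convolution_support:
  fixes A B :: "'g::linordered_ab_group_add set"
  assumes "wfp_on A (<)" "wfp_on B (<)"
  shows "finite {g \<in> A. k - g \<in> B}"
proof (rule finite_if_wfp_on_both)
  show "wfp_on {g \<in> A. k - g \<in> B} (<)" by (rule wfp_on_subset[OF assms(1)]) auto
  have "wfp_on ((\<lambda>g. k - g) ` {g \<in> A. k - g \<in> B}) (<)" by (rule wfp_on_subset[OF assms(2)]) auto
  then show "wfp_on {g \<in> A. k - g \<in> B} (>)" by (simp add: wfp_on_image)
qed

section \<open>The field of Hahn series\<close>

typedef (overloaded) ('f::zero, 'g::linorder) hahn =
  "{c :: 'g \<Rightarrow> 'f. wfp_on {g. c g \<noteq> 0} (<)}"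
  morphisms hcoeff Abs_hahn
  by (rule exI[of _ "\<lambda>_. 0"]) (simp add: wfp_on_iff_ex_minimal)

setup_lifting type_definition_hahn

lemma hahn_eqI: "(\<And>g. hcoeff x g = hcoeff y g) \<Longrightarrow> x = y"
  by (meson ext hcoeff_inject)

lemma wfp_on_hcoeff: "wfp_on {g. hcoeff x g \<noteq> 0} (<)"
  using hcoeff by auto

instantiation hahn :: (zero, linorder) zero
begin
lift_definition zero_hahn :: "('a, 'b) hahn" is "\<lambda>_. 0"
  by (simp add: wfp_on_iff_ex_minimal)
instance ..
end

lemma hcoeff_0 [simp]: "hcoeff 0 g = 0"
  by transfer simp

lemma hahn_nonzero_iff: "x \<noteq> 0 \<longleftrightarrow> (\<exists>g. hcoeff x g \<noteq> 0)"
  by (metis hahn_eqI hcoeff_0)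

lift_definition hmonom :: "'f::zero \<Rightarrow> 'g::linorder \<Rightarrow> ('f, 'g) hahn" is
  "\<lambda>c g h. if h = g then c else 0"
  by (auto simp: wfp_on_iff_ex_minimal)

lemma hcoeff_hmonom: "hcoeff (hmonom c g) h = (if h = g then c else 0)"
  by transfer simp

instantiation hahn :: (zero_neq_one, "{zero, linorder}") one
begin
definition one_hahn :: "('a, 'b) hahn" where "one_hahn = hmonom 1 0"
instance ..
end

instantiation hahn :: (ab_group_add, linorder) ab_group_add
begin
lift_definition plus_hahn :: "('a, 'b) hahn \<Rightarrow> ('a, 'b) hahn \<Rightarrow> ('a, 'b) hahn" is
  "\<lambda>c d g. c g + d g"
  by (drule (1) wfp_on_Un_less, erule wfp_on_subset) auto
lift_definition uminus_hahn :: "('a, 'b) hahn \<Rightarrow> ('a, 'b) hahn" is "\<lambda>c g. - c g"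
  by simp
lift_definition minus_hahn :: "('a, 'b) hahn \<Rightarrow> ('a, 'b) hahn \<Rightarrow> ('a, 'b) hahn" is
  "\<lambda>c d g. c g - d g"
  by (drule (1) wfp_on_Un_less, erule wfp_on_subset) auto
instance
  by intro_classes (transfer; simp add: algebra_simps fun_eq_iff)+
end

lemma hcoeff_add [simp]: "hcoeff (x + y) g = hcoeff x g + hcoeff y g"
  by transfer simp

lemma hcoeff_uminus [simp]: "hcoeff (- x) g = - hcoeff x g"
  by transfer simp

lemma hcoeff_diff [simp]: "hcoeff (x - y) g = hcoeff x g - hcoeff y g"
  by transfer simp

text \<open>The sum defining a coefficient of a product ranges over a finite set by
  \<open>finite_convolution_support\<close>.\<close>

instantiation hahn :: (comm_ring_1, linordered_ab_group_add) times
begin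
lift_definition times_hahn :: "('a, 'b) hahn \<Rightarrow> ('a, 'b) hahn \<Rightarrow> ('a, 'b) hahn" is
  "\<lambda>c d k. \<Sum>g\<in>{g. c g \<noteq> 0 \<and> d (k - g) \<noteq> 0}. c g * d (k - g)"
proof -
  fix c d :: "'b \<Rightarrow> 'a"
  assume "wfp_on {g. c g \<noteq> 0} (<)" "wfp_on {g. d g \<noteq> 0} (<)"
  then have w: "wfp_on {a + b |a b. a \<in> {g. c g \<noteq> 0} \<and> b \<in> {g. d g \<noteq> 0}} (<)" by (rule wfp_on_sumset)
  have "{k. (\<Sum>g\<in>{g. c g \<noteq> 0 \<and> d (k - g) \<noteq> 0}. c g * d (k - g)) \<noteq> 0}
     \<subseteq> {a + b |a b. a \<in> {g. c g \<noteq> 0} \<and> b \<in> {g. d g \<noteq> 0}}"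
  proof
    fix k assume "k \<in> {k. (\<Sum>g\<in>{g. c g \<noteq> 0 \<and> d (k - g) \<noteq> 0}. c g * d (k - g)) \<noteq> 0}"
    then have "(\<Sum>g\<in>{g. c g \<noteq> 0 \<and> d (k - g) \<noteq> 0}. c g * d (k - g)) \<noteq> 0" by simp
    then obtain g where "c g \<noteq> 0" "d (k - g) \<noteq> 0" by (rule sum.not_neutral_contains_not_neutral) auto
    moreover have "k = g + (k - g)" by simp
    ultimately show "k \<in> {a + b |a b. a \<in> {g. c g \<noteq> 0} \<and> b \<in> {g. d g \<noteq> 0}}" by blast
  qed
  then show "wfp_on {k. (\<Sum>g\<in>{g. c g \<noteq> 0 \<and> d (k - g) \<noteq> 0}. c g * d (k - g)) \<noteq> 0} (<)"
    by (rule wfp_on_subset[OF w])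
qed
instance ..
end

lemma hcoeff_times:
  "hcoeff (x * y) k = (\<Sum>g\<in>{g. hcoeff x g \<noteq> 0 \<and> hcoeff y (k - g) \<noteq> 0}. hcoeff x g * hcoeff y (k - g))"
  by transfer simp

lemma finite_hconv:
  fixes x y :: "('f::zero, 'g::linordered_ab_group_add) hahn"
  shows "finite {g. hcoeff x g \<noteq> 0 \<and> hcoeff y (k - g) \<noteq> 0}"
  using finite_convolution_support[OF wfp_on_hcoeff[of x] wfp_on_hcoeff[of y], of k] by simp

lemma hcoeff_times_superset:
  assumes "finite S" "{g. hcoeff x g \<noteq> 0 \<and> hcoeff y (k - g) \<noteq> 0} \<subseteq> S"
  shows "hcoeff (x * y) k = (\<Sum>g\<in>S. hcoeff x g * hcoeff y (k - g))"
  unfolding hcoeff_times by (rule sum.mono_neutral_left) (use assms in auto)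

lemma hcoeff_times_nonzeroD:
  "hcoeff (x * y) k \<noteq> 0 \<Longrightarrow> \<exists>g. hcoeff x g \<noteq> 0 \<and> hcoeff y (k - g) \<noteq> 0"
  unfolding hcoeff_times by (erule sum.not_neutral_contains_not_neutral) auto

lemma hahn_mult_commute: "x * y = y * (x :: ('f::comm_ring_1, 'g::linordered_ab_group_add) hahn)"
proof (rule hahn_eqI)
  fix k show "hcoeff (x * y) k = hcoeff (y * x) k"
    unfolding hcoeff_times
    by (rule sum.reindex_bij_witness[of _ "\<lambda>g. k - g" "\<lambda>g. k - g"]) (auto simp: mult.commute)
qed

lemma hahn_distrib: "(x + y) * z = x * z + y * (z :: ('f::comm_ring_1, 'g::linordered_ab_group_add) hahn)"
proof (rule hahn_eqI)
  fix k
  let ?S = "{g. hcoeff x g \<noteq> 0 \<and> hcoeff z (k - g) \<noteq> 0} \<union> {g. hcoeff y g \<noteq> 0 \<and> hcoeff z (k - g) \<noteq> 0}"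
  have f: "finite ?S" using finite_hconv by blast
  show "hcoeff ((x + y) * z) k = hcoeff (x * z + y * z) k"
    unfolding hcoeff_add
    by (subst (1 2 3) hcoeff_times_superset[OF f]) (auto simp: sum.distrib distrib_right)
qed

lemma hahn_mult_assoc: "(x * y) * z = x * (y * (z :: ('f::comm_ring_1, 'g::linordered_ab_group_add) hahn))"
proof (rule hahn_eqI)
  fix k
  let ?X = "{g. hcoeff x g \<noteq> 0}" and ?Y = "{g. hcoeff y g \<noteq> 0}" and ?Z = "{g. hcoeff z g \<noteq> 0}"
  define M where "M = {m \<in> {a + b |a b. a \<in> ?X \<and> b \<in> ?Y}. k - m \<in> ?Z}"
  define G where "G = {g \<in> ?X. k - g \<in> {a + b |a b. a \<in> ?Y \<and> b \<in> ?Z}}"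
  let ?M = "\<lambda>m. {g. hcoeff x g \<noteq> 0 \<and> hcoeff y (m - g) \<noteq> 0}"
  let ?G = "\<lambda>g. {h. hcoeff y h \<noteq> 0 \<and> hcoeff z (k - g - h) \<noteq> 0}"
  have fM: "finite M" unfolding M_def
    by (intro finite_convolution_support wfp_on_sumset wfp_on_hcoeff)
  have fG: "finite G" unfolding G_def
    by (intro finite_convolution_support wfp_on_sumset wfp_on_hcoeff)
  have sM: "{g. hcoeff (x * y) g \<noteq> 0 \<and> hcoeff z (k - g) \<noteq> 0} \<subseteq> M"
  proof
    fix m assume "m \<in> {g. hcoeff (x * y) g \<noteq> 0 \<and> hcoeff z (k - g) \<noteq> 0}"
    moreover from this obtain g where "hcoeff x g \<noteq> 0" "hcoeff y (m - g) \<noteq> 0"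
      using hcoeff_times_nonzeroD by blast
    moreover have "m = g + (m - g)" by simp
    ultimately show "m \<in> M" unfolding M_def by blast
  qed
  have sG: "{g. hcoeff x g \<noteq> 0 \<and> hcoeff (y * z) (k - g) \<noteq> 0} \<subseteq> G"
  proof
    fix m assume "m \<in> {g. hcoeff x g \<noteq> 0 \<and> hcoeff (y * z) (k - g) \<noteq> 0}"
    moreover from this obtain g where "hcoeff y g \<noteq> 0" "hcoeff z (k - m - g) \<noteq> 0"
      using hcoeff_times_nonzeroD by blast
    moreover have "k - m = g + (k - m - g)" by simp
    ultimately show "m \<in> G" unfolding G_def by blast
  qed
  have "hcoeff (x * y * z) k = (\<Sum>m\<in>M. \<Sum>g\<in>?M m. hcoeff x g * hcoeff y (m - g) * hcoeff z (k - m))"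
    by (subst hcoeff_times_superset[OF fM sM]) (simp add: hcoeff_times sum_distrib_right)
  also have "\<dots> = (\<Sum>(m, g)\<in>Sigma M ?M. hcoeff x g * hcoeff y (m - g) * hcoeff z (k - m))"
    by (rule sum.Sigma) (auto simp: fM finite_hconv)
  also have "\<dots> = (\<Sum>(g, h)\<in>Sigma G ?G. hcoeff x g * (hcoeff y h * hcoeff z (k - g - h)))"
  proof (rule sum.reindex_bij_witness[of _ "\<lambda>(g, h). (g + h, g)" "\<lambda>(m, g). (g, m - g)"])
    fix p assume "p \<in> Sigma M ?M"
    then obtain m g where p: "p = (m, g)" "m \<in> M" "hcoeff x g \<noteq> 0" "hcoeff y (m - g) \<noteq> 0" by auto
    have "k - g = (m - g) + (k - m)" by simp
    moreover have "hcoeff z (k - m) \<noteq> 0" using p by (simp add: M_def)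
    ultimately have "g \<in> G" unfolding G_def using p by blast
    then show "(case p of (m, g) \<Rightarrow> (g, m - g)) \<in> Sigma G ?G"
      using p \<open>hcoeff z (k - m) \<noteq> 0\<close> by (simp add: algebra_simps)
  next
    fix p assume "p \<in> Sigma G ?G"
    then obtain g h where p: "p = (g, h)" "g \<in> G" "hcoeff y h \<noteq> 0" "hcoeff z (k - g - h) \<noteq> 0" by auto
    have "hcoeff x g \<noteq> 0" using p by (simp add: G_def)
    then have "g + h \<in> M" unfolding M_def using p by (auto simp: algebra_simps)
    then show "(case p of (g, h) \<Rightarrow> (g + h, g)) \<in> Sigma M ?M"
      using p \<open>hcoeff x g \<noteq> 0\<close> by simp
  qed (auto simp: algebra_simps)
  also have "\<dots> = (\<Sum>g\<in>G. \<Sum>h\<in>?G g. hcoeff x g * (hcoeff y h * hcoeff z (k - g - h)))"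
    by (rule sum.Sigma[symmetric]) (auto simp: fG finite_hconv)
  also have "\<dots> = hcoeff (x * (y * z)) k"
    by (subst hcoeff_times_superset[OF fG sG]) (simp add: hcoeff_times sum_distrib_left)
  finally show "hcoeff (x * y * z) k = hcoeff (x * (y * z)) k" .
qed

lemma hcoeff_hmonom_times: "hcoeff (hmonom c g * x) k = c * hcoeff x (k - g)"
  by (subst hcoeff_times_superset[of "{g}"]) (auto simp: hcoeff_hmonom split: if_splits)

instance hahn :: (comm_ring_1, linordered_ab_group_add) comm_ring_1
proof
  fix x y z :: "('a, 'b) hahn"
  show "x * y * z = x * (y * z)" by (rule hahn_mult_assoc)
  show "x * y = y * x" by (rule hahn_mult_commute)
  show "(x + y) * z = x * z + y * z" by (rule hahn_distrib)
  show "1 * x = x" by (rule hahn_eqI) (simp add: one_hahn_def hcoeff_hmonom_times)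
  show "(0 :: ('a, 'b) hahn) \<noteq> 1"
    by (metis hcoeff_0 hcoeff_hmonom one_hahn_def zero_neq_one)
qed

definition lead_exp :: "('f::zero, 'g::linorder) hahn \<Rightarrow> 'g" where
  "lead_exp x = (LEAST g. hcoeff x g \<noteq> 0)"

definition leading_coeff :: "('f::zero, 'g::linorder) hahn \<Rightarrow> 'f" where
  "leading_coeff x = hcoeff x (lead_exp x)"

lemma
  assumes "x \<noteq> 0"
  shows leading_coeff_nonzero: "leading_coeff x \<noteq> 0"
    and lead_exp_le: "hcoeff x h \<noteq> 0 \<Longrightarrow> lead_exp x \<le> h"
proof -
  have "{g. hcoeff x g \<noteq> 0} \<noteq> {}" using assms hahn_nonzero_iff by auto
  then obtain m where m: "hcoeff x m \<noteq> 0" "\<And>h. hcoeff x h \<noteq> 0 \<Longrightarrow> m \<le> h"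
    using wfp_on_hcoeff[of x] unfolding wfp_on_iff_ex_minimal
    by (metis (mono_tags, lifting) linorder_not_less mem_Collect_eq subset_refl)
  then have "lead_exp x = m" unfolding lead_exp_def by (intro Least_equality)
  with m show "leading_coeff x \<noteq> 0" "hcoeff x h \<noteq> 0 \<Longrightarrow> lead_exp x \<le> h"
    by (auto simp: leading_coeff_def)
qed

lemma hcoeff_less_lead_exp: "h < lead_exp x \<Longrightarrow> hcoeff x h = 0"
  by (metis hcoeff_0 lead_exp_le leD)

lemma lead_exp_eqI:
  assumes "hcoeff x g \<noteq> 0" "\<And>h. h < g \<Longrightarrow> hcoeff x h = 0"
  shows "lead_exp x = g" "leading_coeff x = hcoeff x g"
proof -
  show "lead_exp x = g" unfolding lead_exp_def
    by (rule Least_equality) (use assms in \<open>auto simp: not_less[symmetric]\<close>)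
  then show "leading_coeff x = hcoeff x g" by (simp add: leading_coeff_def)
qed

lemma hcoeff_times_below:
  fixes x y :: "('f::comm_ring_1, 'g::linordered_ab_group_add) hahn"
  assumes "\<And>a. a < g \<Longrightarrow> hcoeff x a = 0" "\<And>b. b < h \<Longrightarrow> hcoeff y b = 0" "k < g + h"
  shows "hcoeff (x * y) k = 0"
proof (rule ccontr)
  assume "hcoeff (x * y) k \<noteq> 0"
  then obtain a where a: "hcoeff x a \<noteq> 0" "hcoeff y (k - a) \<noteq> 0" using hcoeff_times_nonzeroD by blast
  then have "g \<le> a" "h \<le> k - a" using assms by (meson not_less)+
  then have "g + h \<le> a + (k - a)" by (rule add_mono)
  with assms(3) show False by simp
qed

lemma hcoeff_times_lead:
  fixes x y :: "('f::comm_ring_1, 'g::linordered_ab_group_add) hahn"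
  assumes "\<And>a. a < g \<Longrightarrow> hcoeff x a = 0" "\<And>b. b < h \<Longrightarrow> hcoeff y b = 0"
  shows "hcoeff (x * y) (g + h) = hcoeff x g * hcoeff y h"
proof -
  have "{a. hcoeff x a \<noteq> 0 \<and> hcoeff y (g + h - a) \<noteq> 0} \<subseteq> {g}"
  proof clarsimp
    fix a assume a: "hcoeff x a \<noteq> 0" "hcoeff y (g + h - a) \<noteq> 0"
    then have "g \<le> a" "h \<le> g + h - a" using assms by (meson not_less)+
    then show "a = g" by (simp add: algebra_simps)
  qed
  then have "hcoeff (x * y) (g + h) = (\<Sum>a\<in>{g}. hcoeff x a * hcoeff y (g + h - a))"
    by (intro hcoeff_times_superset) auto
  then show ?thesis by simp
qed

lemma
  fixes x y :: "('f::idom, 'g::linordered_ab_group_add) hahn"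
  assumes "x \<noteq> 0" "y \<noteq> 0"
  shows lead_exp_times: "lead_exp (x * y) = lead_exp x + lead_exp y"
    and leading_coeff_times: "leading_coeff (x * y) = leading_coeff x * leading_coeff y"
    and hahn_times_nonzero: "x * y \<noteq> 0"
proof -
  have l: "hcoeff (x * y) (lead_exp x + lead_exp y) = leading_coeff x * leading_coeff y"
    unfolding leading_coeff_def by (rule hcoeff_times_lead) (auto simp: hcoeff_less_lead_exp)
  then have n: "hcoeff (x * y) (lead_exp x + lead_exp y) \<noteq> 0" 
    using leading_coeff_nonzero[OF assms(1)] leading_coeff_nonzero[OF assms(2)] by simp
  then show "x * y \<noteq> 0" by auto
  have z: "hcoeff (x * y) k = 0" if "k < lead_exp x + lead_exp y" for k
    by (rule hcoeff_times_below[OF _ _ that]) (auto simp: hcoeff_less_lead_exp)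
  show "lead_exp (x * y) = lead_exp x + lead_exp y" by (rule lead_exp_eqI[OF n z])
  show "leading_coeff (x * y) = leading_coeff x * leading_coeff y"
    using lead_exp_eqI(2)[OF n z] l by simp
qed

lift_definition htrunc :: "'g::linorder \<Rightarrow> ('f::zero, 'g) hahn \<Rightarrow> ('f, 'g) hahn" is
  "\<lambda>g c h. if h < g then c h else 0"
  by (rule wfp_on_subset) auto

lemma hcoeff_htrunc: "hcoeff (htrunc g x) h = (if h < g then hcoeff x h else 0)"
  by transfer simp

text \<open>Invertibility: the truncations of the inverse of a series x are uniquely determined, and
  glue to an inverse.\<close>

lemma hahn_inverse_exists:
  fixes x :: "('f::field, 'g::linordered_ab_group_add) hahn"
  assumes "x \<noteq> 0"
  shows "\<exists>y. x * y = 1"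
proof -
  define l where "l = lead_exp x"
  have xl: "hcoeff x l \<noteq> 0" using leading_coeff_nonzero[OF assms] by (simp add: l_def leading_coeff_def)
  have xz: "hcoeff x h = 0" if "h < l" for h using that by (simp add: l_def hcoeff_less_lead_exp)
  define approx where "approx g y \<longleftrightarrow>
      (\<forall>h\<ge>g. hcoeff y h = 0) \<and> (\<forall>k<l + g. hcoeff (1 - x * y) k = 0)" for g y
  have sum0: "hcoeff (x * z) k = 0" if "\<And>h. h < g \<Longrightarrow> hcoeff z h = 0" "k < l + g" for z g k
    using hcoeff_times_below[of l x g z k] xz that by blast
  have uniq: "hcoeff y h = hcoeff y' h" if y: "approx g y" "approx g' y'" "h < g" "h < g'" for g g' y y' h
  proof (rule ccontr)
    assume ne: "hcoeff y h \<noteq> hcoeff y' h"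
    define d where "d = y - y'"
    have "d \<noteq> 0" using ne by (auto simp: d_def)
    have dh: "hcoeff d h \<noteq> 0" using ne by (simp add: d_def)
    then have le: "lead_exp d \<le> h" by (rule lead_exp_le[OF \<open>d \<noteq> 0\<close>])
    have "hcoeff (x * d) (l + lead_exp d) = hcoeff x l * leading_coeff d"
      unfolding leading_coeff_def by (rule hcoeff_times_lead) (auto simp: xz hcoeff_less_lead_exp)
    then have "hcoeff (x * d) (l + lead_exp d) \<noteq> 0" using xl leading_coeff_nonzero[OF \<open>d \<noteq> 0\<close>] by simp
    moreover have "x * d = (1 - x * y') - (1 - x * y)" by (simp add: d_def algebra_simps)
    moreover have "l + lead_exp d < l + g" "l + lead_exp d < l + g'" using le y by auto
    moreover from this have "hcoeff (1 - x * y) (l + lead_exp d) = 0" "hcoeff (1 - x * y') (l + lead_exp d) = 0"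
      using y(1,2) unfolding approx_def by blast+
    ultimately show False by simp
  qed
  define D where "D = {g. \<exists>y. approx g y}"
  define Y where "Y g = (SOME y. approx g y)" for g
  have Y: "approx g (Y g)" if "g \<in> D" for g 
    using that unfolding D_def Y_def by (auto intro: someI_ex)
  define c where "c h = (if \<exists>g\<in>D. h < g then hcoeff (Y (SOME g. g \<in> D \<and> h < g)) h else 0)" for h
  have c_eq: "c h = hcoeff (Y g) h" if "g \<in> D" "h < g" for g h
  proof -
    define g' where "g' = (SOME g. g \<in> D \<and> h < g)"
    have g': "g' \<in> D" "h < g'"
      using someI[of "\<lambda>g. g \<in> D \<and> h < g" g] that by (auto simp: g'_def)
    have "c h = hcoeff (Y g') h" using that unfolding c_def g'_def by auto
    also have "\<dots> = hcoeff (Y g) h" by (rule uniq[OF Y[OF g'(1)] Y[OF that(1)] g'(2) that(2)])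
    finally show ?thesis .
  qed
  have "wfp_on {h. c h \<noteq> 0} (<)"
    unfolding wfp_on_iff_ex_minimal
  proof (intro allI impI)
    fix B assume B: "B \<subseteq> {h. c h \<noteq> 0}" "B \<noteq> {}"
    then obtain b where b: "b \<in> B" "c b \<noteq> 0" by blast
    then obtain g where g: "g \<in> D" "b < g" unfolding c_def by (auto split: if_splits)
    have sub: "B \<inter> {..<g} \<subseteq> {h. hcoeff (Y g) h \<noteq> 0}" using B c_eq[OF g(1)] by auto
    then obtain z where z: "z \<in> B \<inter> {..<g}" "\<forall>y. y < z \<longrightarrow> y \<notin> B \<inter> {..<g}"
      using wfp_on_hcoeff[of "Y g", unfolded wfp_on_iff_ex_minimal] b g by blast
    then show "\<exists>z\<in>B. \<forall>y. y < z \<longrightarrow> y \<notin> B" by (intro bexI[of _ z]) auto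
  qed
  then obtain y where y: "\<And>h. hcoeff y h = c h" using Abs_hahn_inverse by (metis (mono_tags) mem_Collect_eq)
  have small: "hcoeff (1 - x * y) k = 0" if "g \<in> D" "k < l + g" for g k
  proof -
    have "hcoeff (x * (y - Y g)) k = 0" by (rule sum0[OF _ that(2)]) (simp add: y c_eq[OF that(1)])
    moreover have "hcoeff (1 - x * Y g) k = 0" using Y[OF that(1)] that(2) by (simp add: approx_def)
    ultimately show ?thesis by (simp add: algebra_simps)
  qed
  show ?thesis
  proof (rule ccontr)
    assume "\<nexists>y. x * y = 1"
    then have nz: "1 - x * y' \<noteq> 0" for y' by (metis eq_iff_diff_eq_0)
    define h where "h = lead_exp (1 - x * y) - l"
    have notin: "g \<notin> D" if "h < g" for g
    proof
      assume "g \<in> D"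
      moreover have "lead_exp (1 - x * y) < l + g" using that by (simp add: h_def algebra_simps)
      ultimately show False using small leading_coeff_nonzero[OF nz] by (metis leading_coeff_def)
    qed
    have yh: "hcoeff y k = 0" if "h \<le> k" for k
      using notin that le_less_trans unfolding y c_def by metis
    define y' where "y' = y + hmonom (leading_coeff (1 - x * y) / hcoeff x l) h"
    have dif: "1 - x * y' = (1 - x * y) - hmonom (leading_coeff (1 - x * y) / hcoeff x l) h * x"
      by (simp add: y'_def algebra_simps)
    have z: "hcoeff (1 - x * y') k = 0" if "k \<le> l + h" for k
    proof (cases "k = l + h")
      case True
      then have "k = lead_exp (1 - x * y)" by (simp add: h_def)
      moreover have "k - h = l" using True by simp
      ultimately show ?thesis unfolding dif hcoeff_diff[of "1 - x * y"] hcoeff_hmonom_times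
        using xl by (simp add: leading_coeff_def)
    next
      case False
      then have k: "k < l + h" using that by simp
      then have "k < lead_exp (1 - x * y)" "k - h < l" by (simp_all add: h_def algebra_simps)
      then show ?thesis unfolding dif hcoeff_diff[of "1 - x * y"] hcoeff_hmonom_times
        using xz hcoeff_less_lead_exp by (metis diff_zero mult_zero_right)
    qed
    define g where "g = lead_exp (1 - x * y') - l"
    have "l + h < lead_exp (1 - x * y')"
      using z leading_coeff_nonzero[OF nz[of y']] by (metis leading_coeff_def not_less)
    then have hg: "h < g" by (simp add: g_def algebra_simps)
    have "approx g y'" unfolding approx_def
    proof (intro conjI allI impI)
      fix k assume "g \<le> k"
      then show "hcoeff y' k = 0" using yh[of k] hg by (auto simp: y'_def hcoeff_hmonom)
    next
      fix k assume "k < l + g"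
      then show "hcoeff (1 - x * y') k = 0" by (intro hcoeff_less_lead_exp) (simp add: g_def)
    qed
    then show False using notin[OF hg] by (auto simp: D_def)
  qed
qed

instantiation hahn :: (field, linordered_ab_group_add) field
begin
definition inverse_hahn :: "('a, 'b) hahn \<Rightarrow> ('a, 'b) hahn" where
  "inverse_hahn x = (if x = 0 then 0 else SOME y. x * y = 1)"
definition divide_hahn :: "('a, 'b) hahn \<Rightarrow> ('a, 'b) hahn \<Rightarrow> ('a, 'b) hahn" where
  "divide_hahn x y = x * inverse y"
instance
proof
  fix x y :: "('a, 'b) hahn"
  show "inverse x * x = 1" if "x \<noteq> 0"
    using someI_ex[OF hahn_inverse_exists[OF that]] that
    by (simp add: inverse_hahn_def mult.commute)
  show "x div y = x * inverse y" by (rule divide_hahn_def)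
  show "inverse (0 :: ('a, 'b) hahn) = 0" by (simp add: inverse_hahn_def)
qed
end

section \<open>Tracts\<close>

text \<open>The group \<open>F\<^sup>\<times>\<close> is the underlying monoid record, so \<open>carrier T\<close> consists of the nonzero
  elements only; \<open>telems T\<close> is \<open>F = F\<^sup>\<times> \<union> {0}\<close>.  Formal sums over \<open>F\<^sup>\<times>\<close> with natural number
  coefficients are finite multisets.\<close>

record 'a tract = "'a monoid" +
  tzero :: 'a
  null_set :: "'a multiset set"

definition telems :: "('a, 'm) tract_scheme \<Rightarrow> 'a set" where
  "telems T = insert (tzero T) (carrier T)"

definition tmult :: "('a, 'm) tract_scheme \<Rightarrow> 'a \<Rightarrow> 'a \<Rightarrow> 'a" where
  "tmult T a b = (if a = tzero T \<or> b = tzero T then tzero T else a \<otimes>\<^bsub>T\<^esub> b)"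

locale tract = comm_group T for T :: "('a, 'm) tract_scheme" (structure) +
  assumes tzero_notin: "tzero T \<notin> carrier T"
    and null_set_subset: "M \<in> null_set T \<Longrightarrow> set_mset M \<subseteq> carrier T"
    and empty_null: "{#} \<in> null_set T"
    and one_not_null: "{#\<one>#} \<notin> null_set T"
    and ex1_neg: "\<exists>!e. e \<in> carrier T \<and> {#\<one>, e#} \<in> null_set T"
    and null_scale: "M \<in> null_set T \<Longrightarrow> c \<in> carrier T \<Longrightarrow> image_mset (\<lambda>a. c \<otimes> a) M \<in> null_set T"

definition tneg_one :: "('a, 'm) tract_scheme \<Rightarrow> 'a" where
  "tneg_one T = (THE e. e \<in> carrier T \<and> {#\<one>\<^bsub>T\<^esub>, e#} \<in> null_set T)"

text \<open>The formal sum of \<open>f i\<close> over \<open>i \<in> A\<close>, with zero terms dropped.\<close>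

definition formal_sum :: "('a, 'm) tract_scheme \<Rightarrow> ('i \<Rightarrow> 'a) \<Rightarrow> 'i set \<Rightarrow> 'a multiset" where
  "formal_sum T f A = {#a \<in># image_mset f (mset_set A). a \<noteq> tzero T#}"

definition tract_hom :: "('a, 'm) tract_scheme \<Rightarrow> ('b, 'n) tract_scheme \<Rightarrow> ('a \<Rightarrow> 'b) \<Rightarrow> bool" where
  "tract_hom T1 T2 f \<longleftrightarrow> f \<in> hom T1 T2 \<and> f (tzero T1) = tzero T2 \<and>
     (\<forall>M\<in>null_set T1. image_mset f M \<in> null_set T2)"

definition tract_involution :: "('a, 'm) tract_scheme \<Rightarrow> ('a \<Rightarrow> 'a) \<Rightarrow> bool" where
  "tract_involution T \<sigma> \<longleftrightarrow> tract_hom T T \<sigma> \<and> (\<forall>a\<in>telems T. \<sigma> (\<sigma> a) = a)"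

text \<open>Covectors are formed with respect to a chosen involution of the tract, so comparing covectors
  along \<open>f\<close> requires \<open>f\<close> to commute with the chosen involutions of its source and target.\<close>

definition compatible_involutions ::
  "('a, 'm) tract_scheme \<Rightarrow> ('b, 'n) tract_scheme \<Rightarrow> ('a \<Rightarrow> 'b) \<Rightarrow> ('a \<Rightarrow> 'a) \<Rightarrow> ('b \<Rightarrow> 'b) \<Rightarrow> bool" where
  "compatible_involutions T1 T2 f \<sigma> \<tau> \<longleftrightarrow> tract_involution T1 \<sigma> \<and> tract_involution T2 \<tau> \<and>
     (\<forall>a\<in>telems T1. f (\<sigma> a) = \<tau> (f a))"

definition field_tract :: "'k::field tract" where
  "field_tract = \<lparr>carrier = {a. a \<noteq> 0}, monoid.mult = (*), one = 1, tzero = 0,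
     null_set = {M. 0 \<notin># M \<and> sum_mset M = 0}\<rparr>"

definition krasner :: "int tract" where
  "krasner = \<lparr>carrier = {1}, monoid.mult = (*), one = 1, tzero = 0,
     null_set = insert {#} {replicate_mset k 1 |k. k \<ge> 2}\<rparr>"

definition sign_hyperfield :: "int tract" where
  "sign_hyperfield = \<lparr>carrier = {1, - 1}, monoid.mult = (*), one = 1, tzero = 0,
     null_set = insert {#} {replicate_mset k 1 + replicate_mset l (- 1) |k l. k \<ge> 1 \<and> l \<ge> 1}\<rparr>"

text \<open>The tropical extension \<open>F[\<Gamma>]\<close>; the element \<open>(a, \<gamma>)\<close> is \<open>Some (a, \<gamma>)\<close>, and \<open>\<infinity>\<close> is \<open>None\<close>.\<close>

definition leading_part :: "('a \<times> 'g::linorder) option multiset \<Rightarrow> 'a multiset" where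
  "leading_part M =
     image_mset (\<lambda>x. fst (the x)) {#x \<in># M. \<forall>y\<in>#M. snd (the x) \<le> snd (the y)#}"

definition tropical_extension ::
  "('a, 'm) tract_scheme \<Rightarrow> ('a \<times> 'g::linordered_ab_group_add) option tract" where
  "tropical_extension F = \<lparr>carrier = Some ` (carrier F \<times> UNIV),
     monoid.mult = (\<lambda>x y. case (x, y) of
       (Some (a, g), Some (b, h)) \<Rightarrow> Some (a \<otimes>\<^bsub>F\<^esub> b, g + h) | _ \<Rightarrow> None),
     one = Some (\<one>\<^bsub>F\<^esub>, 0), tzero = None,
     null_set = {M. set_mset M \<subseteq> Some ` (carrier F \<times> UNIV) \<and> (M = {#} \<or> leading_part M \<in> null_set F)}\<rparr>"

section \<open>Enriched valuations\<close>

definition enriched_valuation ::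
  "('a, 'm) tract_scheme \<Rightarrow> ('k::field \<Rightarrow> ('a \<times> 'g::linordered_ab_group_add) option) \<Rightarrow> bool" where
  "enriched_valuation F \<nu> \<longleftrightarrow> tract_hom field_tract (tropical_extension F) \<nu> \<and>
     \<nu> ` telems field_tract = telems (tropical_extension F)"

definition val :: "('f::zero, 'g::linorder) hahn \<Rightarrow> (int \<times> 'g) option" where
  "val x = (if x = 0 then None else Some (1, lead_exp x))"

definition sval :: "('f::linordered_field, 'g::linorder) hahn \<Rightarrow> (int \<times> 'g) option" where
  "sval x = (if x = 0 then None else Some (if leading_coeff x > 0 then 1 else - 1, lead_exp x))"

definition fval :: "('f::zero, 'g::linorder) hahn \<Rightarrow> ('f \<times> 'g) option" where
  "fval x = (if x = 0 then None else Some (leading_coeff x, lead_exp x))"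

section \<open>Matroids over tracts\<close>

definition exchange_sign :: "('a, 'm) tract_scheme \<Rightarrow> 'e::linorder \<Rightarrow> 'e set \<Rightarrow> 'e set \<Rightarrow> 'a" where
  "exchange_sign T j I J = tneg_one T [^]\<^bsub>T\<^esub> (card {j' \<in> J. j < j'} + card {i \<in> I. j < i})"

text \<open>Functions on \<open>r\<close>-subsets and tuples indexed by \<open>E\<close> are extensional, so that equality of
  functions is equality on the relevant domain.  A matroid is literally an equivalence class of
  (strong) Pluecker vectors.\<close>

definition plucker_vectors ::
  "('a, 'm) tract_scheme \<Rightarrow> 'e::linorder set \<Rightarrow> nat \<Rightarrow> ('e set \<Rightarrow> 'a) set" where
  "plucker_vectors T E r = {P \<in> nsets E r \<rightarrow>\<^sub>E telems T.
     (\<exists>S\<in>nsets E r. P S \<noteq> tzero T) \<and>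
     (\<forall>I\<in>nsets E (r - 1). \<forall>J\<in>nsets E (r + 1).
        formal_sum T (\<lambda>j. tmult T (exchange_sign T j I J) (tmult T (P (insert j I)) (P (J - {j})))) (J - I)
          \<in> null_set T)}"

definition scaling_rel ::
  "('a, 'm) tract_scheme \<Rightarrow> 'e::linorder set \<Rightarrow> nat \<Rightarrow> (('e set \<Rightarrow> 'a) \<times> ('e set \<Rightarrow> 'a)) set" where
  "scaling_rel T E r = {(P, Q). P \<in> plucker_vectors T E r \<and> Q \<in> plucker_vectors T E r \<and>
     (\<exists>c\<in>carrier T. Q = (\<lambda>S\<in>nsets E r. tmult T c (P S)))}"

definition matroids ::
  "('a, 'm) tract_scheme \<Rightarrow> 'e::linorder set \<Rightarrow> nat \<Rightarrow> ('e set \<Rightarrow> 'a) set set" where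
  "matroids T E r = plucker_vectors T E r // scaling_rel T E r"

text \<open>If \<open>t = {i\<^sub>0 < \<dots> < i\<^sub>r}\<close>, the position \<open>s\<close> of \<open>i\<^sub>s\<close> is the number of elements of \<open>t\<close> below it.\<close>

definition circuit_vector ::
  "('a, 'm) tract_scheme \<Rightarrow> 'e::linorder set \<Rightarrow> ('e set \<Rightarrow> 'a) \<Rightarrow> 'e set \<Rightarrow> 'e \<Rightarrow> 'a" where
  "circuit_vector T E P t = (\<lambda>i\<in>E. if i \<in> t
     then tmult T (tneg_one T [^]\<^bsub>T\<^esub> card {j \<in> t. j < i}) (P (t - {i})) else tzero T)"

definition circuits ::
  "('a, 'm) tract_scheme \<Rightarrow> 'e::linorder set \<Rightarrow> nat \<Rightarrow> ('e set \<Rightarrow> 'a) set \<Rightarrow> ('e \<Rightarrow> 'a) set" where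
  "circuits T E r M = {(\<lambda>i\<in>E. tmult T c (circuit_vector T E P t i)) |c P t.
     c \<in> carrier T \<and> P \<in> M \<and> t \<in> nsets E (r + 1) \<and> (\<exists>i\<in>E. circuit_vector T E P t i \<noteq> tzero T)}"

definition covectors ::
  "('a, 'm) tract_scheme \<Rightarrow> ('a \<Rightarrow> 'a) \<Rightarrow> 'e::linorder set \<Rightarrow> nat \<Rightarrow> ('e set \<Rightarrow> 'a) set \<Rightarrow> ('e \<Rightarrow> 'a) set" where
  "covectors T \<sigma> E r M = {Y \<in> E \<rightarrow>\<^sub>E telems T.
     \<forall>C\<in>circuits T E r M. formal_sum T (\<lambda>i. tmult T (C i) (\<sigma> (Y i))) E \<in> null_set T}"

definition pushforward ::
  "('b, 'n) tract_scheme \<Rightarrow> ('a \<Rightarrow> 'b) \<Rightarrow> 'e::linorder set \<Rightarrow> nat \<Rightarrow> ('e set \<Rightarrow> 'a) set \<Rightarrow> ('e set \<Rightarrow> 'b) set" where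
  "pushforward T f E r M = (\<Union>P\<in>M. scaling_rel T E r `` {\<lambda>S\<in>nsets E r. f (P S)})"

section \<open>The tracts and valuations above are instances\<close>

lemma sum_mset_scale: "sum_mset (image_mset (\<lambda>a. c * a) M) = c * sum_mset (M :: 'k::comm_ring_1 multiset)"
  by (induction M) (auto simp: algebra_simps)

lemma tract_field_tract: "tract (field_tract :: 'k::field tract)"
proof
  show "carrier (field_tract :: 'k tract) \<subseteq> Units field_tract"
  proof
    fix x :: 'k assume "x \<in> carrier field_tract"
    then show "x \<in> Units field_tract"
      by (auto simp: Units_def field_tract_def intro!: exI[of _ "inverse x"])
  qed
  show "\<exists>!e. e \<in> carrier field_tract \<and> {#\<one>\<^bsub>field_tract\<^esub>, e :: 'k#} \<in> null_set field_tract"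
    by (rule ex1I[of _ "- 1"]) (auto simp: field_tract_def eq_neg_iff_add_eq_0 add.commute)
qed (auto simp: field_tract_def sum_mset_scale)

lemma null_set_krasner: "M \<in> null_set krasner \<longleftrightarrow> set_mset M \<subseteq> {1} \<and> size M \<noteq> 1"
proof
  assume r: "set_mset M \<subseteq> {1} \<and> size M \<noteq> 1"
  then have M: "M = replicate_mset (size M) 1" by (metis set_mset_subset_singletonD size_replicate_mset)
  show "M \<in> null_set krasner"
  proof (cases "M = {#}")
    case False
    with r have "size M \<ge> 2" by (metis One_nat_def Suc_leI le_neq_implies_less nonempty_has_size numeral_2_eq_2)
    with M show ?thesis unfolding krasner_def tract.select_convs by blast
  qed (simp add: krasner_def)
next
  assume "M \<in> null_set krasner"
  then show "set_mset M \<subseteq> {1} \<and> size M \<noteq> 1" by (auto simp: krasner_def in_replicate_mset)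
qed

lemma tract_krasner: "tract krasner"
proof
  show "carrier krasner \<subseteq> Units krasner" by (auto simp: Units_def krasner_def)
  show "\<exists>!e. e \<in> carrier krasner \<and> {#\<one>\<^bsub>krasner\<^esub>, e#} \<in> null_set krasner"
    by (rule ex1I[of _ 1]) (simp_all add: null_set_krasner, simp_all add: krasner_def)
next
  fix M c assume "M \<in> null_set krasner" "c \<in> carrier krasner"
  then show "image_mset (\<lambda>a. c \<otimes>\<^bsub>krasner\<^esub> a) M \<in> null_set krasner"
    unfolding null_set_krasner by (auto simp: krasner_def)
next
  fix M assume "M \<in> null_set krasner"
  then show "set_mset M \<subseteq> carrier krasner"
    unfolding null_set_krasner by (auto simp: krasner_def)
qed (simp_all add: null_set_krasner, simp_all add: krasner_def)

lemma null_set_sign_hyperfield: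
  "M \<in> null_set sign_hyperfield \<longleftrightarrow> set_mset M \<subseteq> {1, - 1} \<and> (M = {#} \<or> 1 \<in># M \<and> - 1 \<in># M)"
proof
  assume r: "set_mset M \<subseteq> {1, - 1} \<and> (M = {#} \<or> 1 \<in># M \<and> - 1 \<in># M)"
  have "M = replicate_mset (count M 1) 1 + replicate_mset (count M (- 1)) (- 1)"
  proof (rule multiset_eqI)
    fix x show "count M x = count (replicate_mset (count M 1) 1 + replicate_mset (count M (- 1)) (- 1)) x"
      using r by (cases "x \<in># M") (auto simp: not_in_iff)
  qed
  moreover have "M = {#} \<or> count M 1 \<ge> 1 \<and> count M (- 1) \<ge> 1" using r by auto
  ultimately show "M \<in> null_set sign_hyperfield"
    unfolding sign_hyperfield_def tract.select_convs by blast
qed (auto simp: sign_hyperfield_def in_replicate_mset split: if_splits)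

lemma tract_sign_hyperfield: "tract sign_hyperfield"
proof
  show "carrier sign_hyperfield \<subseteq> Units sign_hyperfield" by (auto simp: Units_def sign_hyperfield_def)
  show "\<exists>!e. e \<in> carrier sign_hyperfield \<and> {#\<one>\<^bsub>sign_hyperfield\<^esub>, e#} \<in> null_set sign_hyperfield"
    by (rule ex1I[of _ "- 1"]) (simp_all add: null_set_sign_hyperfield, auto simp: sign_hyperfield_def)
next
  fix M c assume "M \<in> null_set sign_hyperfield" "c \<in> carrier sign_hyperfield"
  then have M: "set_mset M \<subseteq> {1, - 1}" "M = {#} \<or> 1 \<in># M \<and> - 1 \<in># M" "c = 1 \<or> c = - 1"
    unfolding null_set_sign_hyperfield by (auto simp: sign_hyperfield_def)
  show "image_mset (\<lambda>a. c \<otimes>\<^bsub>sign_hyperfield\<^esub> a) M \<in> null_set sign_hyperfield"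
    using M(3)
  proof
    assume "c = - 1"
    then show ?thesis using M(1,2) unfolding null_set_sign_hyperfield
      by (auto simp: sign_hyperfield_def image_iff intro!: bexI[of _ "- 1"])
  qed (use M(1,2) in \<open>simp add: null_set_sign_hyperfield, simp add: sign_hyperfield_def\<close>)
next
  fix M assume "M \<in> null_set sign_hyperfield"
  then show "set_mset M \<subseteq> carrier sign_hyperfield"
    unfolding null_set_sign_hyperfield by (auto simp: sign_hyperfield_def)
qed (simp_all add: null_set_sign_hyperfield, auto simp: sign_hyperfield_def)

lemma null_set_tropical_extension:
  "M \<in> null_set (tropical_extension F) \<longleftrightarrow>
     set_mset M \<subseteq> Some ` (carrier F \<times> UNIV) \<and> (M = {#} \<or> leading_part M \<in> null_set F)"
  by (simp add: tropical_extension_def)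

lemma tropical_extension_simps [simp]:
  "carrier (tropical_extension F) = Some ` (carrier F \<times> UNIV)"
  "Some (a, g) \<otimes>\<^bsub>tropical_extension F\<^esub> Some (b, h) = Some (a \<otimes>\<^bsub>F\<^esub> b, g + h)"
  "\<one>\<^bsub>tropical_extension F\<^esub> = Some (\<one>\<^bsub>F\<^esub>, 0)"
  "tzero (tropical_extension F) = None"
  by (simp_all add: tropical_extension_def)

lemma tract_tropical_extension:
  assumes "tract F"
  shows "tract (tropical_extension F :: ('a \<times> 'g::linordered_ab_group_add) option tract)"
proof -
  interpret F: tract F by fact
  let ?T = "tropical_extension F :: ('a \<times> 'g) option tract"
  show ?thesis
  proof
    show "carrier ?T \<subseteq> Units ?T"
    proof
      fix x assume "x \<in> carrier ?T"
      then obtain a g where x: "x = Some (a, g)" "a \<in> carrier F" by auto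
      have "Some (inv\<^bsub>F\<^esub> a, - g) \<otimes>\<^bsub>?T\<^esub> x = \<one>\<^bsub>?T\<^esub>" "x \<otimes>\<^bsub>?T\<^esub> Some (inv\<^bsub>F\<^esub> a, - g) = \<one>\<^bsub>?T\<^esub>"
        using x by auto
      moreover have "Some (inv\<^bsub>F\<^esub> a, - g) \<in> carrier ?T" "x \<in> carrier ?T" using x by auto
      ultimately show "x \<in> Units ?T" unfolding Units_def by blast
    qed
  next
    have pair: "{#Some (\<one>\<^bsub>F\<^esub>, 0), Some (b, h)#} \<in> null_set ?T \<longleftrightarrow> b \<in> carrier F \<and> h = 0 \<and> {#\<one>\<^bsub>F\<^esub>, b#} \<in> null_set F"
      for b and h :: 'g
    proof -
      have "{#b#} \<notin> null_set F"
      proof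
        assume *: "{#b#} \<in> null_set F"
        then have "b \<in> carrier F" using F.null_set_subset by fastforce
        then show False using F.null_scale[OF *, of "inv\<^bsub>F\<^esub> b"] F.one_not_null by simp
      qed
      then show ?thesis
        using F.one_not_null
        by (cases "0::'g" h rule: linorder_cases)
          (auto simp: null_set_tropical_extension leading_part_def)
    qed
    obtain e where e: "e \<in> carrier F" "{#\<one>\<^bsub>F\<^esub>, e#} \<in> null_set F"
      "\<And>e'. e' \<in> carrier F \<Longrightarrow> {#\<one>\<^bsub>F\<^esub>, e'#} \<in> null_set F \<Longrightarrow> e' = e"
      using F.ex1_neg by auto
    show "\<exists>!e. e \<in> carrier ?T \<and> {#\<one>\<^bsub>?T\<^esub>, e#} \<in> null_set ?T"
    proof (rule ex1I[of _ "Some (e, 0)"])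
      show "Some (e, 0) \<in> carrier ?T \<and> {#\<one>\<^bsub>?T\<^esub>, Some (e, 0)#} \<in> null_set ?T"
        using e(1,2) unfolding tropical_extension_simps pair by blast
    next
      fix x assume x: "x \<in> carrier ?T \<and> {#\<one>\<^bsub>?T\<^esub>, x#} \<in> null_set ?T"
      then obtain b h where b: "x = Some (b, h)" by auto
      with x have "b \<in> carrier F \<and> h = 0 \<and> {#\<one>\<^bsub>F\<^esub>, b#} \<in> null_set F"
        unfolding tropical_extension_simps b pair by blast
      with e(3) b show "x = Some (e, 0)" by blast
    qed
  next
    fix M c assume M: "M \<in> null_set ?T" and "c \<in> carrier ?T"
    then obtain a g where c: "c = Some (a, g)" "a \<in> carrier F" by auto
    have sub: "set_mset M \<subseteq> Some ` (carrier F \<times> UNIV)" using M by (simp add: null_set_tropical_extension)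
    have snd: "snd (the (c \<otimes>\<^bsub>?T\<^esub> x)) = g + snd (the x)" and fst: "fst (the (c \<otimes>\<^bsub>?T\<^esub> x)) = a \<otimes>\<^bsub>F\<^esub> fst (the x)"
      if "x \<in># M" for x
      using sub that c by auto
    have "leading_part (image_mset (\<lambda>x. c \<otimes>\<^bsub>?T\<^esub> x) M) = image_mset (\<lambda>b. a \<otimes>\<^bsub>F\<^esub> b) (leading_part M)"
      unfolding leading_part_def filter_mset_image_mset multiset.map_comp
      by (intro multiset.map_cong filter_mset_cong) (auto simp: snd fst)
    moreover have "set_mset (image_mset (\<lambda>x. c \<otimes>\<^bsub>?T\<^esub> x) M) \<subseteq> Some ` (carrier F \<times> UNIV)"
      using sub c by auto
    ultimately show "image_mset (\<lambda>x. c \<otimes>\<^bsub>?T\<^esub> x) M \<in> null_set ?T"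
      using M F.null_scale[OF _ c(2)] by (auto simp: null_set_tropical_extension)
  next
    show "{#\<one>\<^bsub>?T\<^esub>#} \<notin> null_set ?T"
      using F.one_not_null by (simp add: null_set_tropical_extension leading_part_def)
  qed (auto simp: F.m_assoc F.m_comm F.m_lcomm add.assoc add.commute null_set_tropical_extension)
qed

lemma hcoeff_sum_mset: "hcoeff (sum_mset M) g = sum_mset (image_mset (\<lambda>x. hcoeff x g) M)"
  by (induction M) auto

lemma enriched_valuation_leading:
  fixes F :: "'a tract" and \<phi> :: "'f::field \<Rightarrow> 'a"
    and \<nu> :: "('f, 'g::linordered_ab_group_add) hahn \<Rightarrow> ('a \<times> 'g) option"
  assumes hom: "tract_hom field_tract F \<phi>" and surj: "\<phi> ` {a. a \<noteq> 0} = carrier F"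
    and \<nu>: "\<And>x. \<nu> x = (if x = 0 then None else Some (\<phi> (leading_coeff x), lead_exp x))"
  shows "enriched_valuation F \<nu>"
proof -
  have \<phi>: "a \<noteq> 0 \<Longrightarrow> \<phi> a \<in> carrier F" "a \<noteq> 0 \<Longrightarrow> b \<noteq> 0 \<Longrightarrow> \<phi> (a * b) = \<phi> a \<otimes>\<^bsub>F\<^esub> \<phi> b" for a b
    using hom by (auto simp: tract_hom_def hom_def field_tract_def)
  have "\<nu> \<in> hom field_tract (tropical_extension F)"
    by (rule homI) (auto simp: field_tract_def \<nu> \<phi> leading_coeff_nonzero lead_exp_times leading_coeff_times)
  moreover have "image_mset \<nu> M \<in> null_set (tropical_extension F)" if "M \<in> null_set field_tract" for M
  proof (cases "M = {#}")
    case False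
    have M: "0 \<notin># M" "sum_mset M = 0" using that by (auto simp: field_tract_def)
    then have nz: "x \<noteq> 0" if "x \<in># M" for x using that by blast
    define g where "g = Min (lead_exp ` set_mset M)"
    have gle: "g \<le> lead_exp x" if "x \<in># M" for x using that by (simp add: g_def)
    have gin: "g \<in> lead_exp ` set_mset M" unfolding g_def using False by (intro Min_in) auto
    have minimal: "(\<forall>y\<in>#M. lead_exp x \<le> lead_exp y) \<longleftrightarrow> lead_exp x = g" if "x \<in># M" for x
      using gle gin that by (metis antisym imageE)
    define L where "L = {#x \<in># M. lead_exp x = g#}"
    have "leading_part (image_mset \<nu> M) = image_mset (\<phi> \<circ> leading_coeff) L"
      unfolding leading_part_def filter_mset_image_mset multiset.map_comp L_def
      by (intro multiset.map_cong filter_mset_cong) (auto simp: \<nu> nz minimal)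
    also have "\<dots> = image_mset \<phi> (image_mset leading_coeff L)" by (simp add: multiset.map_comp)
    finally have lp: "leading_part (image_mset \<nu> M) = image_mset \<phi> (image_mset leading_coeff L)" .
    have "0 = sum_mset (image_mset (\<lambda>x. hcoeff x g) M)" using M(2) hcoeff_sum_mset by (metis hcoeff_0)
    also have "image_mset (\<lambda>x. hcoeff x g) M = image_mset (\<lambda>x. if lead_exp x = g then leading_coeff x else 0) M"
    proof (rule image_mset_cong)
      fix x assume "x \<in># M"
      then show "hcoeff x g = (if lead_exp x = g then leading_coeff x else 0)"
        using gle[of x] hcoeff_less_lead_exp[of g x] by (auto simp: leading_coeff_def)
    qed
    also have "sum_mset \<dots> = sum_mset (image_mset leading_coeff L)"
      unfolding L_def by (induction M) auto
    finally have "sum_mset (image_mset leading_coeff L) = 0" by simp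
    moreover have "0 \<notin># image_mset leading_coeff L"
    proof
      assume "0 \<in># image_mset leading_coeff L"
      then obtain x where "x \<in># M" "leading_coeff x = 0" by (auto simp: L_def)
      then show False using leading_coeff_nonzero[OF nz] by blast
    qed
    ultimately have "image_mset \<phi> (image_mset leading_coeff L) \<in> null_set F"
      using hom by (auto simp: tract_hom_def field_tract_def)
    moreover have "set_mset (image_mset \<nu> M) \<subseteq> Some ` (carrier F \<times> UNIV)"
      using nz \<phi>(1)[OF leading_coeff_nonzero] by (auto simp: \<nu>)
    ultimately show ?thesis by (simp add: null_set_tropical_extension lp)
  qed (simp add: null_set_tropical_extension)
  moreover have "\<nu> ` telems field_tract = telems (tropical_extension F)"
  proof -
    have "\<exists>x. x \<noteq> 0 \<and> \<nu> x = Some (a, g)" if a: "a \<in> carrier F" for a g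
    proof -
      obtain c where c: "c \<noteq> 0" "\<phi> c = a" using a unfolding surj[symmetric] by blast
      have "hmonom c g \<noteq> 0" using c by (metis hcoeff_0 hcoeff_hmonom)
      moreover have "lead_exp (hmonom c g) = g" "leading_coeff (hmonom c g) = c"
        using lead_exp_eqI[of "hmonom c g" g] c by (auto simp: hcoeff_hmonom)
      ultimately show ?thesis using c \<nu> by metis
    qed
    then have "Some ` (carrier F \<times> UNIV) \<subseteq> range \<nu>" by (auto simp: image_iff) metis
    moreover have "None \<in> range \<nu>" using \<nu>[of 0] by (metis rangeI)
    moreover have "range \<nu> \<subseteq> insert None (Some ` (carrier F \<times> UNIV))"
      using \<phi>(1)[OF leading_coeff_nonzero] by (auto simp: \<nu>)
    ultimately have "range \<nu> = insert None (Some ` (carrier F \<times> UNIV))" by blast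
    moreover have "telems field_tract = (UNIV :: ('f, 'g) hahn set)"
      by (auto simp: telems_def field_tract_def)
    ultimately show ?thesis by (simp add: telems_def)
  qed
  moreover have "\<nu> (tzero field_tract) = tzero (tropical_extension F)"
    by (simp add: field_tract_def \<nu>)
  ultimately show ?thesis unfolding enriched_valuation_def tract_hom_def by blast
qed

lemma enriched_valuation_val:
  "enriched_valuation krasner (val :: ('f::field, 'g::linordered_ab_group_add) hahn \<Rightarrow> _)"
proof (rule enriched_valuation_leading)
  show "tract_hom field_tract krasner (\<lambda>a :: 'f. if a = 0 then 0 else 1)"
    unfolding tract_hom_def
  proof (intro conjI ballI)
    fix M :: "'f multiset" assume "M \<in> null_set field_tract"
    then have M: "0 \<notin># M" "sum_mset M = 0" by (auto simp: field_tract_def)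
    have "size M \<noteq> 1"
    proof
      assume "size M = 1"
      then obtain a where "M = {#a#}" using size_1_singleton_mset by blast
      then show False using M by simp
    qed
    then show "image_mset (\<lambda>a :: 'f. if a = 0 then 0 else 1) M \<in> null_set krasner"
      using M(1) by (auto simp: null_set_krasner)
  qed (auto simp: field_tract_def krasner_def hom_def)
  show "(\<lambda>a :: 'f. if a = 0 then 0 else 1) ` {a. a \<noteq> 0} = carrier krasner"
    by (auto simp: krasner_def image_iff) (metis zero_neq_one)
qed (simp add: val_def leading_coeff_nonzero)

lemma enriched_valuation_sval:
  "enriched_valuation sign_hyperfield (sval :: ('f::linordered_field, 'g::linordered_ab_group_add) hahn \<Rightarrow> _)"
proof (rule enriched_valuation_leading)
  define \<phi> :: "'f \<Rightarrow> int" where "\<phi> a = (if a = 0 then 0 else if a > 0 then 1 else - 1)" for a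
  have pos: "sum_mset N > 0" if "N \<noteq> {#}" "\<forall>a\<in>#N. a > 0" for N :: "'f multiset"
    using that
  proof (induction N)
    case (add x N)
    then show ?case by (cases "N = {#}") (auto intro: add_pos_pos)
  qed simp
  show "tract_hom field_tract sign_hyperfield \<phi>"
    unfolding tract_hom_def
  proof (intro conjI ballI)
    fix M :: "'f multiset" assume "M \<in> null_set field_tract"
    then have M: "0 \<notin># M" "sum_mset M = 0" by (auto simp: field_tract_def)
    have nz: "a \<noteq> 0" if "a \<in># M" for a using M(1) that by blast
    have "\<exists>a\<in>#M. a < 0" if "M \<noteq> {#}"
      using pos[of M] that M(2) nz by (metis less_irrefl linorder_neqE)
    moreover have "\<exists>a\<in>#M. a > 0" if "M \<noteq> {#}"
    proof (rule ccontr)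
      assume "\<not> (\<exists>a\<in>#M. a > 0)"
      then have "\<forall>a\<in>#image_mset (\<lambda>a. - 1 * a) M. a > 0" using nz by (auto simp: not_less) (metis order.not_eq_order_implies_strict)
      then have "sum_mset (image_mset (\<lambda>a. - 1 * a) M) > 0" using that by (intro pos) auto
      then show False using M(2) unfolding sum_mset_scale by simp
    qed
    ultimately have "M = {#} \<or> (\<exists>a\<in>#M. \<phi> a = 1) \<and> (\<exists>a\<in>#M. \<phi> a = - 1)"
      by (metis \<phi>_def less_irrefl order.asym)
    then have "image_mset \<phi> M = {#} \<or> 1 \<in># image_mset \<phi> M \<and> - 1 \<in># image_mset \<phi> M"
      by (metis image_eqI image_mset_is_empty_iff set_image_mset)
    moreover have "set_mset (image_mset \<phi> M) \<subseteq> {1, - 1}" using nz by (auto simp: \<phi>_def)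
    ultimately show "image_mset \<phi> M \<in> null_set sign_hyperfield"
      unfolding null_set_sign_hyperfield by blast
  qed (auto simp: field_tract_def sign_hyperfield_def hom_def \<phi>_def zero_less_mult_iff not_less mult_le_0_iff)
  have "\<phi> 1 = 1" "\<phi> (- 1) = - 1" by (simp_all add: \<phi>_def)
  then have "{1, - 1} \<subseteq> \<phi> ` {a. a \<noteq> 0}"
    by (metis (mono_tags, lifting) empty_subsetI image_eqI insert_subset mem_Collect_eq neg_equal_0_iff_equal zero_neq_one)
  then show "\<phi> ` {a. a \<noteq> 0} = carrier sign_hyperfield"
    by (auto simp: sign_hyperfield_def \<phi>_def)
  show "sval x = (if x = 0 then None else Some (\<phi> (leading_coeff x), lead_exp x))" for x :: "('f, 'g) hahn"
    by (simp add: sval_def leading_coeff_nonzero \<phi>_def)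
qed

lemma enriched_valuation_fval:
  "enriched_valuation field_tract (fval :: ('f::field, 'g::linordered_ab_group_add) hahn \<Rightarrow> _)"
  by (rule enriched_valuation_leading[where \<phi> = "\<lambda>a. a"])
    (auto simp: fval_def tract_hom_def hom_def field_tract_def)

end

theory Submission
  imports Defs
begin

text \<open>One inclusion holds because \<open>\<nu>\<close> is a homomorphism of tracts.  For the other, let \<open>Y\<close> be a covector
  of the push-forward and choose any tuple \<open>z\<close> with \<open>\<nu>(z) = Y\<close>.  Contracting a maximal independent set
  of coordinates at which \<open>Y\<close> is infinite, and rescaling the other coordinates by \<open>z\<close>, we may assume
  that all entries of \<open>Y\<close> are \<open>(1, 0)\<close>.  The coefficients of the Pluecker vector at its minimal
  exponent form a Pluecker vector over the residue field \<open>\<bbbF>\<close>, and \<open>Y\<close> being a covector says that the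
  all-ones tuple is a covector of the image of this initial matroid in \<open>F\<close>.  Suppose that it lifts to
  a covector \<open>a\<close> over \<open>\<bbbF>\<close>.  Prescribing the constant series \<open>a\<^sub>b\<close> on a basis of the initial matroid
  determines a covector over the Hahn series, and the fundamental circuits of this basis force its
  reduction to be \<open>a\<close>.

  It remains to find \<open>a\<close> over \<open>\<bbbF>\<close>.  For \<open>fval\<close> this is the tuple of ones.  For \<open>val\<close> it is a covector without
  zeros, which is a generic combination of covectors that are nonzero at one coordinate each.  For
  \<open>sval\<close> it is a positive covector, by Minty's dichotomy
  (of a linear subspace and its orthogonal complement, one contains a nonnegative vector that is
  positive at a given coordinate).  In the last two cases an obstruction would
  be a vector orthogonal to all covectors, which may be taken of minimal support and is then a
  multiple of a circuit, contradicting that \<open>Y\<close> is a covector.\<close>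

lemma sum_mult_diff:
  fixes x :: "'i \<Rightarrow> 'k::comm_ring"
  shows "(\<Sum>i\<in>A. x i * (u i - c * v i)) = (\<Sum>i\<in>A. x i * u i) - c * (\<Sum>i\<in>A. x i * v i)"
  by (simp add: right_diff_distrib sum_subtractf sum_distrib_left mult.left_commute)

lemma sum_diff_mult:
  fixes x :: "'i \<Rightarrow> 'k::comm_ring"
  shows "(\<Sum>i\<in>A. (u i - c * v i) * x i) = (\<Sum>i\<in>A. u i * x i) - c * (\<Sum>i\<in>A. v i * x i)"
  by (simp add: left_diff_distrib sum_subtractf sum_distrib_left mult.assoc)

section \<open>Circuits and cocircuits with sign conventions left open\<close>

text \<open>The exponents \<open>\<alpha>\<close> and \<open>\<beta>\<close> of the signs are arbitrary, so that restricting to a contraction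
  only changes \<open>\<alpha>\<close> and \<open>\<beta>\<close> and no signs need to be recomputed.  The Pluecker relations enter
  solely as the orthogonality of \<open>circ\<close> and \<open>cocirc\<close>.\<close>

definition circ :: "('e set \<Rightarrow> 'e \<Rightarrow> nat) \<Rightarrow> ('e set \<Rightarrow> 'k::field) \<Rightarrow> 'e set \<Rightarrow> 'e \<Rightarrow> 'k" where
  "circ \<beta> P J i = (if i \<in> J then (- 1) ^ \<beta> J i * P (J - {i}) else 0)"

definition cocirc :: "('e set \<Rightarrow> 'e \<Rightarrow> nat) \<Rightarrow> ('e set \<Rightarrow> 'k::field) \<Rightarrow> 'e set \<Rightarrow> 'e \<Rightarrow> 'k" where
  "cocirc \<alpha> P I i = (if i \<in> I then 0 else (- 1) ^ \<alpha> I i * P (insert i I))"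

locale signed_plucker =
  fixes S :: "'e set" and r :: nat and \<alpha> \<beta> :: "'e set \<Rightarrow> 'e \<Rightarrow> nat" and P :: "'e set \<Rightarrow> 'k::field"
  assumes finite_ground: "finite S"
    and ex_basis: "\<exists>B\<subseteq>S. card B = r \<and> P B \<noteq> 0"
    and circ_orthogonal_cocirc: "I \<subseteq> S \<Longrightarrow> card I + 1 = r \<Longrightarrow> J \<subseteq> S \<Longrightarrow> card J = r + 1 \<Longrightarrow>
      (\<Sum>i\<in>S. circ \<beta> P J i * cocirc \<alpha> P I i) = 0"
begin

text \<open>For \<open>i\<close> in the basis, the cocircuit of \<open>B - {i}\<close> vanishes on
  \<open>B - {i}\<close> while \<open>v\<close> vanishes off \<open>B\<close>; orthogonality leaves
  only the term at \<open>i\<close>, whose coefficient is \<open>P B\<close> up to sign.\<close>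

lemma vanishes_if_supported_on_basis:
  assumes B: "B \<subseteq> S" "card B = r" "P B \<noteq> 0"
    and v: "\<And>I. I \<subseteq> S \<Longrightarrow> card I + 1 = r \<Longrightarrow> (\<Sum>i\<in>S. v i * cocirc \<alpha> P I i) = 0"
    and supp: "\<And>i. i \<in> S - B \<Longrightarrow> v i = 0" and "i \<in> S"
  shows "v i = 0"
proof (cases "i \<in> B")
  case True
  have fB: "finite B" using B(1) finite_ground finite_subset by blast
  have "0 = (\<Sum>j\<in>S. v j * cocirc \<alpha> P (B - {i}) j)"
    using v[of "B - {i}"] B(1,2) card_Suc_Diff1[OF fB True] by auto
  also have "\<dots> = (\<Sum>j\<in>{i}. v j * cocirc \<alpha> P (B - {i}) j)"
    by (rule sum.mono_neutral_right) (use finite_ground supp \<open>i \<in> S\<close> in \<open>auto simp: cocirc_def\<close>)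
  finally show ?thesis using B(3) True by (simp add: cocirc_def insert_absorb)
qed (use supp \<open>i \<in> S\<close> in blast)

text \<open>A basis \<open>B\<close> meeting the support of \<open>v\<close> in as many elements as
  possible has a fundamental circuit inside that support, and a multiple of it agrees with
  \<open>v\<close> off \<open>B\<close>. Minimality is stated against circuits because the
  application to signs compares \<open>v\<close> with vectors that have a positive entry.\<close>

lemma elementary_is_multiple_of_circ:
  assumes v: "\<And>I. I \<subseteq> S \<Longrightarrow> card I + 1 = r \<Longrightarrow> (\<Sum>i\<in>S. v i * cocirc \<alpha> P I i) = 0"
    and nz: "\<exists>i\<in>S. v i \<noteq> 0"
    and minimal: "\<And>J. J \<subseteq> S \<Longrightarrow> card J = r + 1 \<Longrightarrow> (\<exists>i\<in>S. circ \<beta> P J i \<noteq> 0) \<Longrightarrow>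
      {i \<in> S. circ \<beta> P J i \<noteq> 0} \<subseteq> {i \<in> S. v i \<noteq> 0} \<Longrightarrow> {i \<in> S. v i \<noteq> 0} \<subseteq> {i \<in> S. circ \<beta> P J i \<noteq> 0}"
  shows "\<exists>J c. J \<subseteq> S \<and> card J = r + 1 \<and> c \<noteq> 0 \<and> (\<forall>i\<in>S. v i = c * circ \<beta> P J i)"
proof -
  define D where "D = {i \<in> S. v i \<noteq> 0}"
  have "\<exists>B. (B \<subseteq> S \<and> card B = r \<and> P B \<noteq> 0) \<and>
      (\<forall>B'. B' \<subseteq> S \<and> card B' = r \<and> P B' \<noteq> 0 \<longrightarrow> card (B' \<inter> D) \<le> card (B \<inter> D))"
  proof -
    obtain B0 where "B0 \<subseteq> S" "card B0 = r" "P B0 \<noteq> 0" using ex_basis by blast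
    then show ?thesis
      using ex_has_greatest_nat[of "\<lambda>B. B \<subseteq> S \<and> card B = r \<and> P B \<noteq> 0" B0 "\<lambda>B. card (B \<inter> D)" "Suc (card S)"]
      by (simp add: card_mono[OF finite_ground] le_infI1 less_Suc_eq_le)
  qed
  then obtain B where B: "B \<subseteq> S" "card B = r" "P B \<noteq> 0"
    and max: "\<And>B'. B' \<subseteq> S \<Longrightarrow> card B' = r \<Longrightarrow> P B' \<noteq> 0 \<Longrightarrow> card (B' \<inter> D) \<le> card (B \<inter> D)" by blast
  have fB: "finite B" using B(1) finite_ground finite_subset by blast
  have "\<not> D \<subseteq> B"
    using vanishes_if_supported_on_basis[OF B, of v] v nz unfolding D_def by blast
  then obtain d where d: "d \<in> D" "d \<notin> B" "d \<in> S" unfolding D_def by blast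
  define J where "J = insert d B"
  have J: "J \<subseteq> S" "card J = r + 1" using B d fB by (auto simp: J_def)
  have Jd: "circ \<beta> P J d \<noteq> 0" using B d by (simp add: circ_def J_def)
  \<comment> \<open>A nonzero entry at some \<open>i\<close> outside \<open>D\<close> would make
    \<open>J - {i}\<close>, that is \<open>B\<close> with \<open>i\<close> exchanged for
    \<open>d\<close>, a basis with one more element in \<open>D\<close>.\<close>
  have "{i \<in> S. circ \<beta> P J i \<noteq> 0} \<subseteq> D"
  proof (rule ccontr)
    assume "\<not> ?thesis"
    then obtain i where i: "i \<in> S" "circ \<beta> P J i \<noteq> 0" "i \<notin> D" by blast
    then have iJ: "i \<in> B" "i \<noteq> d" "P (J - {i}) \<noteq> 0"
      using d by (auto simp: circ_def J_def split: if_splits)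
    have "card (J - {i}) = r" using iJ J by (simp add: J_def fB)
    moreover have "J - {i} \<subseteq> S" using J(1) by blast
    ultimately have "card ((J - {i}) \<inter> D) \<le> card (B \<inter> D)" using max[of "J - {i}"] iJ(3) by simp
    moreover have "(J - {i}) \<inter> D = insert d (B \<inter> D)" using i d by (auto simp: J_def)
    ultimately show False using d fB by simp
  qed
  then have DJ: "D \<subseteq> {i \<in> S. circ \<beta> P J i \<noteq> 0}" 
    using minimal[OF J, folded D_def] Jd d(3) by blast
  \<comment> \<open>This ratio makes the difference vanish at \<open>d\<close>; off \<open>J\<close>
    both vectors vanish, so the difference is supported on \<open>B\<close>.\<close>
  define c where "c = v d / circ \<beta> P J d"
  have "v i - c * circ \<beta> P J i = 0" if "i \<in> S" for i
  proof (rule vanishes_if_supported_on_basis[OF B, of "\<lambda>i. v i - c * circ \<beta> P J i"])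
    fix I assume "I \<subseteq> S" "card I + 1 = r"
    then show "(\<Sum>i\<in>S. (v i - c * circ \<beta> P J i) * cocirc \<alpha> P I i) = 0"
      using v[of I] circ_orthogonal_cocirc[of I J] J
      by (simp add: sum_diff_mult)
  next
    fix i assume i: "i \<in> S - B"
    show "v i - c * circ \<beta> P J i = 0"
    proof (cases "i = d")
      case False
      then have "i \<notin> J" using i by (simp add: J_def)
      then have "circ \<beta> P J i = 0" by (simp add: circ_def)
      moreover from this have "v i = 0" using DJ i unfolding D_def by blast
      ultimately show ?thesis by simp
    qed (simp add: c_def Jd)
  qed fact
  moreover have "c \<noteq> 0" using d Jd by (simp add: c_def D_def)
  ultimately show ?thesis using J by (intro exI[of _ J] exI[of _ c]) simp
qed

end

section \<open>Covectors of prescribed signs over an ordered field\<close>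

text \<open>Pairing with \<open>v\<close> over \<open>T\<close> kills every \<open>u\<close> in
  \<open>L\<close> with \<open>u f = 0\<close>, so on \<open>L\<close> it is a multiple of
  evaluation at \<open>f\<close>, and \<open>c\<close> cancels that multiple.\<close>

lemma extend_to_orthogonal:
  fixes L :: "('e \<Rightarrow> 'k::field) set"
  assumes T: "finite T" "f \<notin> T"
    and diff: "\<And>u u' c. u \<in> L \<Longrightarrow> u' \<in> L \<Longrightarrow> (\<lambda>i. u i - c * u' i) \<in> L"
    and v: "\<And>u. u \<in> L \<Longrightarrow> u f = 0 \<Longrightarrow> (\<Sum>i\<in>T. u i * v i) = 0"
  shows "\<exists>c. \<forall>u\<in>L. (\<Sum>i\<in>insert f T. u i * (v(f := c)) i) = 0"
proof -
  have split: "(\<Sum>i\<in>insert f T. u i * (v(f := c)) i) = u f * c + (\<Sum>i\<in>T. u i * v i)" for u c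
    using T by (auto intro!: arg_cong2[of _ _ _ _ "(+)"] sum.cong)
  show ?thesis
  proof (cases "\<forall>u\<in>L. u f = 0")
    case True
    then show ?thesis using v unfolding split by simp
  next
    case False
    then obtain w where w: "w \<in> L" "w f \<noteq> 0" by blast
    define c where "c = - (\<Sum>i\<in>T. w i * v i) / w f"
    have "(\<Sum>i\<in>insert f T. u i * (v(f := c)) i) = 0" if u: "u \<in> L" for u
    proof -
      define l where "l = u f / w f"
      have "(\<Sum>i\<in>T. (u i - l * w i) * v i) = 0"
        by (rule v[OF diff[OF u w(1)]]) (simp add: l_def w)
      then have "(\<Sum>i\<in>T. u i * v i) = l * (\<Sum>i\<in>T. w i * v i)"
        by (simp add: sum_diff_mult)
      then show ?thesis unfolding split using w by (simp add: c_def l_def)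
    qed
    then show ?thesis by blast
  qed
qed

text \<open>By deletion and contraction of a coordinate \<open>f\<close>: if neither minor settles the matter, the two
  vectors obtained are both negative at \<open>f\<close>, so their scalar product cannot vanish.\<close>

lemma minty_dichotomy:
  fixes X :: "('e \<Rightarrow> 'k::linordered_field) set"
  assumes "finite T" "e \<notin> T"
  shows "(\<exists>u. (\<forall>x\<in>X. (\<Sum>i\<in>insert e T. x i * u i) = 0) \<and> (\<forall>i\<in>T. u i \<ge> 0) \<and> u e > 0) \<or>
    (\<exists>v. (\<forall>u. (\<forall>x\<in>X. (\<Sum>i\<in>insert e T. x i * u i) = 0) \<longrightarrow> (\<Sum>i\<in>insert e T. u i * v i) = 0) \<and>
      (\<forall>i\<in>T. v i \<ge> 0) \<and> v e > 0)"
  using assms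
proof (induction T arbitrary: X rule: finite_induct)
  case empty
  show ?case
  proof (cases "\<forall>x\<in>X. x e = 0")
    case True
    then show ?thesis by (intro disjI1 exI[of _ "\<lambda>_. 1"]) simp
  next
    case False
    then show ?thesis by (intro disjI2 exI[of _ "\<lambda>_. 1"]) auto
  qed
next
  case (insert f T)
  let ?S = "insert e T"
  have fS: "finite ?S" "f \<notin> ?S" and eT: "e \<notin> T" "e \<noteq> f" using insert by auto
  have ord: "insert e (insert f T) = insert f ?S" by blast
  have split: "(\<Sum>i\<in>insert f ?S. g i) = g f + (\<Sum>i\<in>?S. g i)" for g :: "'e \<Rightarrow> 'k" using fS by simp
  have upd: "(\<Sum>i\<in>?S. x i * (h(f := c)) i) = (\<Sum>i\<in>?S. x i * h i)" for x h :: "'e \<Rightarrow> 'k" and c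
    by (rule sum.cong) (use fS in auto)
  \<comment> \<open>\<open>L\<close> is the orthogonal complement of \<open>X\<close>, and
    \<open>V\<close>, the complement of \<open>L\<close>, stands in for the span of
    \<open>X\<close>. Below, \<open>VI\<close> and \<open>LI'\<close> extend vectors on
    \<open>?S\<close> to members of \<open>V\<close> and \<open>L\<close>.\<close>
  define L where "L = {u. \<forall>x\<in>X. (\<Sum>i\<in>insert f ?S. x i * u i) = 0}"
  define V where "V = {v. \<forall>u\<in>L. (\<Sum>i\<in>insert f ?S. u i * v i) = 0}"
  have Ldiff: "(\<lambda>i. u i - c * u' i) \<in> L" if "u \<in> L" "u' \<in> L" for u u' c
    using that by (simp add: L_def sum_mult_diff)
  have Vdiff: "(\<lambda>i. v i - c * v' i) \<in> V" if "v \<in> V" "v' \<in> V" for v v' c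
    using that by (simp add: V_def sum_mult_diff)
  have XV: "X \<subseteq> V"
    unfolding V_def L_def mem_Collect_eq by (subst mult.commute) blast
  have LI: "u \<in> L" if "\<And>v. v \<in> V \<Longrightarrow> (\<Sum>i\<in>insert f ?S. v i * u i) = 0" for u
    using that XV unfolding L_def by blast
  have VI: "\<exists>c. v(f := c) \<in> V" if "\<And>u. u \<in> L \<Longrightarrow> u f = 0 \<Longrightarrow> (\<Sum>i\<in>?S. u i * v i) = 0" for v
    using extend_to_orthogonal[OF fS, of L v] Ldiff that unfolding V_def by blast
  have LI': "\<exists>c. u(f := c) \<in> L" if "\<And>v. v \<in> V \<Longrightarrow> v f = 0 \<Longrightarrow> (\<Sum>i\<in>?S. v i * u i) = 0" for u
    using extend_to_orthogonal[OF fS, of V u] Vdiff that LI by blast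
  have goal: ?case if "(\<exists>u\<in>L. (\<forall>i\<in>insert f T. u i \<ge> 0) \<and> u e > 0) \<or> (\<exists>v\<in>V. (\<forall>i\<in>insert f T. v i \<ge> 0) \<and> v e > 0)"
    using that unfolding ord L_def V_def by blast
  \<comment> \<open>Restricting \<open>X\<close> to \<open>?S\<close> corresponds to the members of
    \<open>L\<close> that vanish at \<open>f\<close>: a vector \<open>u\<close> from the induction
    hypothesis extends by zero, a vector \<open>v\<close> by a value found with
    \<open>VI\<close>.\<close>
  have contraction: "(\<exists>u\<in>L. (\<forall>i\<in>T. u i \<ge> 0) \<and> u e > 0 \<and> u f = 0) \<or> (\<exists>v\<in>V. (\<forall>i\<in>T. v i \<ge> 0) \<and> v e > 0)"
    using insert.IH[OF eT(1), of X]
  proof (elim disjE exE conjE)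
    fix u assume u: "\<forall>x\<in>X. (\<Sum>i\<in>?S. x i * u i) = 0" "\<forall>i\<in>T. 0 \<le> u i" "0 < u e"
    have "u(f := 0) \<in> L" using u(1) unfolding L_def mem_Collect_eq split upd by simp
    moreover have "\<forall>i\<in>T. 0 \<le> (u(f := 0)) i" "0 < (u(f := 0)) e" "(u(f := 0)) f = 0" using u eT by auto
    ultimately show ?thesis by blast
  next
    fix v assume v: "\<forall>u. (\<forall>x\<in>X. (\<Sum>i\<in>?S. x i * u i) = 0) \<longrightarrow> (\<Sum>i\<in>?S. u i * v i) = 0"
      "\<forall>i\<in>T. 0 \<le> v i" "0 < v e"
    have "(\<Sum>i\<in>?S. u i * v i) = 0" if "u \<in> L" "u f = 0" for u
      using v(1) that unfolding L_def split by simp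
    then obtain c where "v(f := c) \<in> V" using VI by blast
    moreover have "\<forall>i\<in>T. 0 \<le> (v(f := c)) i" "0 < (v(f := c)) e" using v eT insert.hyps(2) by auto
    ultimately show ?thesis by blast
  qed
  \<comment> \<open>Dually, the induction hypothesis is applied to the members of \<open>V\<close>
    that vanish at \<open>f\<close>; now \<open>u\<close> receives a value at \<open>f\<close> and
    \<open>v\<close> extends by zero.\<close>
  have deletion: "(\<exists>u\<in>L. (\<forall>i\<in>T. u i \<ge> 0) \<and> u e > 0) \<or> (\<exists>v\<in>V. (\<forall>i\<in>T. v i \<ge> 0) \<and> v e > 0 \<and> v f = 0)"
    using insert.IH[OF eT(1), of "{v \<in> V. v f = 0}"]
  proof (elim disjE exE conjE)
    fix u assume u: "\<forall>x\<in>{v \<in> V. v f = 0}. (\<Sum>i\<in>?S. x i * u i) = 0" "\<forall>i\<in>T. 0 \<le> u i" "0 < u e"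
    then obtain c where "u(f := c) \<in> L" using LI'[of u] by blast
    moreover have "\<forall>i\<in>T. 0 \<le> (u(f := c)) i" "0 < (u(f := c)) e" using u eT insert.hyps(2) by auto
    ultimately show ?thesis by blast
  next
    fix v assume v: "\<forall>u. (\<forall>x\<in>{v \<in> V. v f = 0}. (\<Sum>i\<in>?S. x i * u i) = 0) \<longrightarrow> (\<Sum>i\<in>?S. u i * v i) = 0"
      "\<forall>i\<in>T. 0 \<le> v i" "0 < v e"
    have "(\<Sum>i\<in>?S. u i * v i) = 0" if "u \<in> L" for u
    proof (rule v(1)[rule_format])
      fix x assume "x \<in> {v \<in> V. v f = 0}"
      then have "x f = 0" "u f * x f + (\<Sum>i\<in>?S. u i * x i) = 0" using that unfolding V_def split by auto
      then show "(\<Sum>i\<in>?S. x i * u i) = 0" by (simp add: mult.commute)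
    qed
    then have "v(f := 0) \<in> V" unfolding V_def mem_Collect_eq split upd by simp
    moreover have "\<forall>i\<in>T. 0 \<le> (v(f := 0)) i" "0 < (v(f := 0)) e" "(v(f := 0)) f = 0" using v eT by auto
    ultimately show ?thesis by blast
  qed
  have clash: False
    if u: "u \<in> L" "\<forall>i\<in>T. u i \<ge> 0" "u e > 0" "u f < 0" and v: "v \<in> V" "\<forall>i\<in>T. v i \<ge> 0" "v e > 0" "v f < 0" for u v
  proof -
    have "0 = u f * v f + (u e * v e + (\<Sum>i\<in>T. u i * v i))"
      using u(1) v(1) fS eT unfolding V_def by (simp add: insert.hyps(1))
    moreover have "u f * v f > 0" "u e * v e > 0" using u v by (auto simp: mult_neg_neg)
    moreover have "(\<Sum>i\<in>T. u i * v i) \<ge> 0" using u v by (intro sum_nonneg) simp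
    ultimately show False by linarith
  qed
  show ?case
  proof (rule goal, rule ccontr)
    assume neg: "\<not> ((\<exists>u\<in>L. (\<forall>i\<in>insert f T. u i \<ge> 0) \<and> u e > 0) \<or> (\<exists>v\<in>V. (\<forall>i\<in>insert f T. v i \<ge> 0) \<and> v e > 0))"
    then obtain v where v: "v \<in> V" "\<forall>i\<in>T. v i \<ge> 0" "v e > 0" using contraction by auto
    obtain u where u: "u \<in> L" "\<forall>i\<in>T. u i \<ge> 0" "u e > 0" using neg deletion by auto
    have "\<not> (\<forall>i\<in>insert f T. v i \<ge> 0)" "\<not> (\<forall>i\<in>insert f T. u i \<ge> 0)"
      using neg u(1,3) v(1,3) by blast+
    then have "v f < 0" "u f < 0" using u(2) v(2) by (auto simp: not_le)
    then show False using clash u v by blast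
  qed
qed

section \<open>Covectors as a linear space; nowhere-zero covectors over an infinite field\<close>

context signed_plucker
begin

text \<open>The involution is left out here; \<open>valuation_covectors\<close> restores it by
  applying it to the entries.\<close>

definition covector :: "('e \<Rightarrow> 'k) \<Rightarrow> bool" where
  "covector u \<longleftrightarrow> (\<forall>J. J \<subseteq> S \<longrightarrow> card J = r + 1 \<longrightarrow> (\<Sum>i\<in>S. circ \<beta> P J i * u i) = 0)"

lemma covector_cocirc:
  "I \<subseteq> S \<Longrightarrow> card I + 1 = r \<Longrightarrow> covector (cocirc \<alpha> P I)"
  using circ_orthogonal_cocirc by (simp add: covector_def)

lemma covector_add:
  "covector u \<Longrightarrow> covector v \<Longrightarrow> covector (\<lambda>i. u i + v i)"
  by (simp add: covector_def distrib_left sum.distrib)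

lemma covector_scale: "covector u \<Longrightarrow> covector (\<lambda>i. c * u i)"
  by (simp add: covector_def mult.left_commute[of _ c] flip: sum_distrib_left)

lemma covector_sum:
  "finite A \<Longrightarrow> (\<And>x. x \<in> A \<Longrightarrow> covector (u x)) \<Longrightarrow> covector (\<lambda>i. \<Sum>x\<in>A. u x i)"
  by (induction A rule: finite_induct) (simp_all add: covector_add, simp add: covector_def)

text \<open>If every covector, in particular every cocircuit, vanished at \<open>e\<close>, the unit
  vector at \<open>e\<close> would be orthogonal to all cocircuits and hence a multiple of a
  circuit, whose support would have one element.\<close>

lemma ex_covector_nonzero_at:
  assumes e: "e \<in> S"
    and circ: "\<And>J. J \<subseteq> S \<Longrightarrow> card J = r + 1 \<Longrightarrow> card {i \<in> S. circ \<beta> P J i \<noteq> 0} \<noteq> 1"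
  shows "\<exists>u. covector u \<and> u e \<noteq> 0"
proof (rule ccontr)
  assume none: "\<nexists>u. covector u \<and> u e \<noteq> 0"
  define v :: "'e \<Rightarrow> 'k" where "v i = (if i = e then 1 else 0)" for i
  have supp: "{i \<in> S. v i \<noteq> 0} = {e}" using e by (auto simp: v_def)
  have "\<exists>J c. J \<subseteq> S \<and> card J = r + 1 \<and> c \<noteq> 0 \<and> (\<forall>i\<in>S. v i = c * circ \<beta> P J i)"
  proof (rule elementary_is_multiple_of_circ)
    fix I assume "I \<subseteq> S" "card I + 1 = r"
    then have "cocirc \<alpha> P I e = 0" using none covector_cocirc by blast
    then show "(\<Sum>i\<in>S. v i * cocirc \<alpha> P I i) = 0"
      by (intro sum.neutral) (simp add: v_def)
  next
    show "\<exists>i\<in>S. v i \<noteq> 0" using e by (auto simp: v_def)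
  next
    fix J assume "\<exists>i\<in>S. circ \<beta> P J i \<noteq> 0" "{i \<in> S. circ \<beta> P J i \<noteq> 0} \<subseteq> {i \<in> S. v i \<noteq> 0}"
    then show "{i \<in> S. v i \<noteq> 0} \<subseteq> {i \<in> S. circ \<beta> P J i \<noteq> 0}" unfolding supp by blast
  qed
  then obtain J c where J: "J \<subseteq> S" "card J = r + 1" "c \<noteq> 0" "\<And>i. i \<in> S \<Longrightarrow> v i = c * circ \<beta> P J i" by blast
  have "{i \<in> S. circ \<beta> P J i \<noteq> 0} = {i \<in> S. v i \<noteq> 0}" using J(3,4) by auto
  then show False using circ[OF J(1,2)] unfolding supp by simp
qed

lemma ex_covector_nowhere_zero:
  assumes inf: "infinite (UNIV :: 'k set)"
    and circ: "\<And>J. J \<subseteq> S \<Longrightarrow> card J = r + 1 \<Longrightarrow> card {i \<in> S. circ \<beta> P J i \<noteq> 0} \<noteq> 1"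
  shows "\<exists>u. covector u \<and> (\<forall>i\<in>S. u i \<noteq> 0)"
proof -
  have "\<exists>u. covector u \<and> (\<forall>i\<in>T. u i \<noteq> 0)" if "T \<subseteq> S" "finite T" for T
    using that(2,1)
  proof (induction T rule: finite_induct)
    case empty
    show ?case by (rule exI[of _ "\<lambda>_. 0"]) (simp add: covector_def)
  next
    case (insert e T)
    then obtain u where u: "covector u" "\<And>i. i \<in> T \<Longrightarrow> u i \<noteq> 0" by auto
    obtain w where w: "covector w" "w e \<noteq> 0" using ex_covector_nonzero_at[of e] circ insert.prems by auto
    have "finite ((\<lambda>i. - u i / w i) ` insert e T)" using insert.hyps by simp
    \<comment> \<open>At a coordinate with \<open>w i \<noteq> 0\<close> the new sum vanishes for a
      single value of \<open>c\<close>. Where \<open>w i = 0\<close>, the excluded value is 0 by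
      convention, and the entry \<open>u i\<close> stays nonzero because \<open>i\<close> differs
      from \<open>e\<close>.\<close>
    then obtain c where c: "c \<notin> (\<lambda>i. - u i / w i) ` insert e T" using inf ex_new_if_finite by blast
    have "u i + c * w i \<noteq> 0" if "i \<in> insert e T" for i
    proof (cases "w i = 0")
      case True
      then show ?thesis using that u(2) w(2) by auto
    next
      case False
      moreover have "c \<noteq> - u i / w i" using c that by blast
      ultimately show ?thesis
        using nonzero_eq_divide_eq[OF False, of c "- u i"] eq_neg_iff_add_eq_0[of "c * w i" "u i"]
        by (simp only: add.commute) blast
    qed
    then show ?case using covector_add[OF u(1) covector_scale[OF w(1), of c]] by blast
  qed
  then show ?thesis using finite_ground by blast
qed

end

section \<open>Positive covectors from circuits with entries of both signs\<close>

lemma ex_positive_covector: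
  fixes P :: "'e set \<Rightarrow> 'k::linordered_field"
  assumes plucker: "signed_plucker S r \<alpha> \<beta> P"
    and circ: "\<And>J. J \<subseteq> S \<Longrightarrow> card J = r + 1 \<Longrightarrow> \<exists>i\<in>S. circ \<beta> P J i \<noteq> 0 \<Longrightarrow>
      (\<exists>i\<in>S. circ \<beta> P J i > 0) \<and> (\<exists>i\<in>S. circ \<beta> P J i < 0)"
  shows "\<exists>u. signed_plucker.covector S r \<beta> P u \<and> (\<forall>i\<in>S. u i > 0)"
proof -
  interpret signed_plucker S r \<alpha> \<beta> P by fact
  define V where "V = {v. \<forall>u. covector u \<longrightarrow> (\<Sum>i\<in>S. v i * u i) = 0}"
  have circV: "circ \<beta> P J \<in> V" if "J \<subseteq> S" "card J = r + 1" for J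
    using that by (simp add: V_def covector_def)
  have Vdiff: "(\<lambda>i. v i - c * v' i) \<in> V" if "v \<in> V" "v' \<in> V" for v v' c
    using that by (simp add: V_def sum_diff_mult)
  \<comment> \<open>A nonnegative vector of least support is a multiple of a circuit, but circuits
    have entries of both signs.\<close>
  have no_nonneg: False if v0: "v0 \<in> V" "\<forall>i\<in>S. v0 i \<ge> 0" "\<exists>i\<in>S. v0 i \<noteq> 0" for v0
  proof -
    define supp :: "('e \<Rightarrow> 'k) \<Rightarrow> 'e set" where "supp v = {i \<in> S. v i \<noteq> 0}" for v
    have fin: "finite (supp v)" for v using finite_ground by (simp add: supp_def)
    define Q where "Q v \<longleftrightarrow> v \<in> V \<and> (\<forall>i\<in>S. v i \<ge> 0) \<and> (\<exists>i\<in>S. v i \<noteq> 0)" for v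
    have "Q v0" using v0 by (simp add: Q_def)
    then obtain v where v: "Q v" and min: "\<And>w. Q w \<Longrightarrow> card (supp v) \<le> card (supp w)"
      using ex_has_least_nat[of Q v0 "\<lambda>v. card (supp v)"] by blast
    have vV: "v \<in> V" and v_ge: "\<And>i. i \<in> S \<Longrightarrow> v i \<ge> 0" using v by (auto simp: Q_def)
    have elementary: "supp v \<subseteq> supp w"
      if w: "w \<in> V" "\<exists>i\<in>S. w i > 0" "supp w \<subseteq> supp v" for w
    proof (rule ccontr)
      assume "\<not> supp v \<subseteq> supp w"
      then obtain d where d: "d \<in> S" "v d \<noteq> 0" "w d = 0" by (auto simp: supp_def)
      define W where "W = {i \<in> S. w i > 0}"
      have W: "finite W" "W \<noteq> {}" using finite_ground w(2) by (auto simp: W_def)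
      \<comment> \<open>The largest multiple of \<open>w\<close> that can be subtracted while
        \<open>v\<close> stays nonnegative. The entry at \<open>k\<close> becomes zero, so the
        support shrinks; the entry at \<open>d\<close> survives because
        \<open>w d = 0\<close>.\<close>
      define l where "l = Min ((\<lambda>i. v i / w i) ` W)"
      have "l \<in> (\<lambda>i. v i / w i) ` W" unfolding l_def using W by (intro Min_in) auto
      then obtain k where k: "k \<in> S" "w k > 0" "l = v k / w k" by (auto simp: W_def)
      have l: "l \<le> v i / w i" if "i \<in> W" for i using that W by (simp add: l_def)
      have l0: "l \<ge> 0" using k v_ge by simp
      define z where "z i = v i - l * w i" for i
      have "z i \<ge> 0" if "i \<in> S" for i
      proof (cases "w i > 0")
        case True
        then show ?thesis using l[of i] that by (simp add: W_def z_def field_simps)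
      next
        case False
        then have "l * w i \<le> 0" using l0 by (simp add: mult_nonneg_nonpos)
        then show ?thesis using v_ge[OF that] by (simp add: z_def)
      qed
      moreover have "z d \<noteq> 0" using d by (simp add: z_def)
      moreover have "z \<in> V" unfolding z_def by (rule Vdiff[OF vV w(1)])
      ultimately have "Q z" using d by (auto simp: Q_def)
      moreover have "supp z \<subset> supp v"
      proof
        show "supp z \<subseteq> supp v" using w(3) by (auto simp: supp_def z_def)
        have "k \<in> supp v" "k \<notin> supp z" using k w(3) by (auto simp: supp_def z_def)
        then show "supp z \<noteq> supp v" by blast
      qed
      then have "card (supp z) < card (supp v)" by (rule psubset_card_mono[OF fin])
      ultimately show False using min[of z] by simp
    qed
    have "\<exists>J c. J \<subseteq> S \<and> card J = r + 1 \<and> c \<noteq> 0 \<and> (\<forall>i\<in>S. v i = c * circ \<beta> P J i)"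
    proof (rule elementary_is_multiple_of_circ)
      fix I assume "I \<subseteq> S" "card I + 1 = r"
      then show "(\<Sum>i\<in>S. v i * cocirc \<alpha> P I i) = 0" using vV covector_cocirc by (simp add: V_def)
    next
      show "\<exists>i\<in>S. v i \<noteq> 0" using v by (simp add: Q_def)
    next
      fix J assume J: "J \<subseteq> S" "card J = r + 1" "\<exists>i\<in>S. circ \<beta> P J i \<noteq> 0"
        and sub: "{i \<in> S. circ \<beta> P J i \<noteq> 0} \<subseteq> {i \<in> S. v i \<noteq> 0}"
      show "{i \<in> S. v i \<noteq> 0} \<subseteq> {i \<in> S. circ \<beta> P J i \<noteq> 0}"
        using elementary[of "circ \<beta> P J"] circV[OF J(1,2)] circ[OF J] sub unfolding supp_def by blast
    qed
    then obtain J c where J: "J \<subseteq> S" "card J = r + 1" "c \<noteq> 0" "\<And>i. i \<in> S \<Longrightarrow> v i = c * circ \<beta> P J i" by blast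
    then have "\<exists>i\<in>S. circ \<beta> P J i \<noteq> 0" using v unfolding Q_def by fastforce
    then obtain i j where ij: "i \<in> S" "j \<in> S" "circ \<beta> P J i > 0" "circ \<beta> P J j < 0" using circ[OF J(1,2)] by blast
    then have "c * circ \<beta> P J i \<ge> 0" "c * circ \<beta> P J j \<ge> 0" using v_ge J(4) by metis+
    then show False using ij J(3) by (auto simp: zero_le_mult_iff)
  qed
  have "\<exists>u. covector u \<and> (\<forall>i\<in>S. u i \<ge> 0) \<and> u e > 0" if e: "e \<in> S" for e
  proof -
    \<comment> \<open>With the circuits as \<open>X\<close>, the first alternative of
      \<open>minty_dichotomy\<close> is a covector positive at \<open>e\<close>, and the second is
      excluded by \<open>no_nonneg\<close>. Summing over \<open>e\<close> gives positivity
      everywhere.\<close>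
    define X where "X = {circ \<beta> P J |J. J \<subseteq> S \<and> card J = r + 1}"
    have cov: "covector u \<longleftrightarrow> (\<forall>x\<in>X. (\<Sum>i\<in>S. x i * u i) = 0)" for u
      by (auto simp: covector_def X_def)
    have S: "insert e (S - {e}) = S" using e by blast
    have "(\<exists>u. covector u \<and> (\<forall>i\<in>S - {e}. u i \<ge> 0) \<and> u e > 0) \<or>
      (\<exists>v. (\<forall>u. covector u \<longrightarrow> (\<Sum>i\<in>S. u i * v i) = 0) \<and> (\<forall>i\<in>S - {e}. v i \<ge> 0) \<and> v e > 0)"
      using minty_dichotomy[of "S - {e}" e X] finite_ground unfolding S cov by simp
    then show ?thesis
    proof
      assume "\<exists>u. covector u \<and> (\<forall>i\<in>S - {e}. u i \<ge> 0) \<and> u e > 0"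
      then obtain u where "covector u" "\<forall>i\<in>S - {e}. u i \<ge> 0" "u e > 0" by blast
      then show ?thesis by (intro exI[of _ u]) force
    next
      assume "\<exists>v. (\<forall>u. covector u \<longrightarrow> (\<Sum>i\<in>S. u i * v i) = 0) \<and> (\<forall>i\<in>S - {e}. v i \<ge> 0) \<and> v e > 0"
      then obtain v where v: "\<forall>u. covector u \<longrightarrow> (\<Sum>i\<in>S. v i * u i) = 0" "\<forall>i\<in>S - {e}. v i \<ge> 0" "v e > 0"
        by (subst (asm) mult.commute) blast
      have "v i \<ge> 0" if "i \<in> S" for i using v that by (cases "i = e") auto
      then show ?thesis using no_nonneg[of v] v e unfolding V_def by force
    qed
  qed
  then obtain u where u: "\<And>e. e \<in> S \<Longrightarrow> covector (u e)" "\<And>e i. e \<in> S \<Longrightarrow> i \<in> S \<Longrightarrow> u e i \<ge> 0"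
    "\<And>e. e \<in> S \<Longrightarrow> u e e > 0" by metis
  have "(\<Sum>e\<in>S. u e i) > 0" if "i \<in> S" for i
    by (rule sum_pos2[OF finite_ground that]) (use u that in auto)
  then show ?thesis using covector_sum[OF finite_ground, of u] u(1)
    by (intro exI[of _ "\<lambda>i. \<Sum>e\<in>S. u e i"]) simp
qed

section \<open>Lifting from the initial matroid\<close>

lemma formal_sum_eq_image_mset:
  assumes "finite A"
  shows "formal_sum T f A = image_mset f (mset_set {i \<in> A. f i \<noteq> tzero T})"
  using assms by (simp add: formal_sum_def filter_mset_image_mset filter_mset_mset_set)

lemma hcoeff_sum: "hcoeff (\<Sum>i\<in>A. x i) g = (\<Sum>i\<in>A. hcoeff (x i) g)"
  by (induction A rule: infinite_finite_induct) simp_all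

lemma hcoeff_neg_one_power_times:
  fixes x :: "('f::comm_ring_1, 'g::linordered_ab_group_add) hahn"
  shows "hcoeff ((- 1) ^ n * x) g = (- 1) ^ n * hcoeff x g"
  by (induction n) (simp_all add: mult.assoc)

lemma sum_circ_insert:
  assumes S: "finite S" "insert e B \<subseteq> S" and e: "e \<notin> B"
  shows "(\<Sum>i\<in>S. circ \<beta> P (insert e B) i * z i)
    = circ \<beta> P (insert e B) e * z e + (\<Sum>b\<in>B. circ \<beta> P (insert e B) b * z b)"
proof -
  have "(\<Sum>i\<in>S. circ \<beta> P (insert e B) i * z i) = (\<Sum>i\<in>insert e B. circ \<beta> P (insert e B) i * z i)"
    by (rule sum.mono_neutral_right) (use S in \<open>auto simp: circ_def\<close>)
  moreover have "finite B" using S finite_subset by auto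
  ultimately show ?thesis using e by simp
qed

text \<open>\<open>\<phi>\<close> is the action of \<open>\<nu>\<close> on leading coefficients,
  extended by zero. The assumption \<open>lift\<close> is the claim over the residue field for the
  all-ones tuple. It ranges over all subsets, ranks and sign exponents because contraction changes
  these.\<close>

locale liftable_valuation =
  fixes F :: "'a tract" and \<phi> :: "'f::field \<Rightarrow> 'a"
    and \<nu> :: "('f, 'g::linordered_ab_group_add) hahn \<Rightarrow> ('a \<times> 'g) option"
    and E :: "'e set"
  assumes tract_F: "tract F"
    and enriched: "enriched_valuation F \<nu>"
    and \<phi>_zero: "\<phi> 0 = tzero F"
    and \<phi>_nonzero: "a \<noteq> 0 \<Longrightarrow> \<phi> a \<in> carrier F"
    and \<nu>: "\<nu> x = (if x = 0 then None else Some (\<phi> (leading_coeff x), lead_exp x))"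
    and finite_E: "finite E"
    and lift: "S \<subseteq> E \<Longrightarrow> signed_plucker S r \<alpha> \<beta> P \<Longrightarrow>
      (\<And>J. J \<subseteq> S \<Longrightarrow> card J = r + 1 \<Longrightarrow> formal_sum F (\<lambda>i. \<phi> (circ \<beta> P J i)) S \<in> null_set F) \<Longrightarrow>
      \<exists>a. signed_plucker.covector S r \<beta> P a \<and> (\<forall>i\<in>S. \<phi> (a i) = \<one>\<^bsub>F\<^esub>)"
begin

abbreviation T :: "('a \<times> 'g) option tract" where "T \<equiv> tropical_extension F"

sublocale F: tract F by (rule tract_F)
sublocale T: tract T by (rule tract_tropical_extension[OF tract_F])

lemma \<phi>_eq_tzero_iff: "\<phi> a = tzero F \<longleftrightarrow> a = 0"
  using \<phi>_zero \<phi>_nonzero F.tzero_notin by metis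

lemma \<nu>_eq_None_iff: "\<nu> x = None \<longleftrightarrow> x = 0"
  by (simp add: \<nu>)

text \<open>If some coefficient at \<open>m\<close> is nonzero, the terms of least exponent are
  exactly those with nonzero coefficient at \<open>m\<close>; otherwise the sum over
  \<open>F\<close> is empty. The second case occurs because \<open>m\<close> will be the least
  exponent of the whole Pluecker vector, which a given circuit need not attain.\<close>

lemma formal_sum_initial_null:
  assumes S: "finite S" and below: "\<And>i h. i \<in> S \<Longrightarrow> h < m \<Longrightarrow> hcoeff (x i) h = 0"
    and null: "formal_sum T (\<lambda>i. \<nu> (x i)) S \<in> null_set T"
  shows "formal_sum F (\<lambda>i. \<phi> (hcoeff (x i) m)) S \<in> null_set F"
proof (cases "\<forall>i\<in>S. hcoeff (x i) m = 0")
  case True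
  then have "{i \<in> S. \<phi> (hcoeff (x i) m) \<noteq> tzero F} = {}" by (auto simp: \<phi>_zero)
  then show ?thesis unfolding formal_sum_eq_image_mset[OF S] by (simp only:) (simp add: F.empty_null)
next
  case False
  then obtain k where k: "k \<in> S" "hcoeff (x k) m \<noteq> 0" by blast
  define S' where "S' = {i \<in> S. x i \<noteq> 0}"
  have fin: "finite S'" using S by (simp add: S'_def)
  have le: "m \<le> lead_exp (x i)" if "i \<in> S'" for i
    using that below[of i "lead_exp (x i)"] leading_coeff_nonzero[of "x i"]
    by (force simp: S'_def leading_coeff_def not_le)
  have kS': "k \<in> S'" "lead_exp (x k) = m" using k below by (auto simp: S'_def intro: lead_exp_eqI)
  have minimal: "(\<forall>j\<in>S'. lead_exp (x i) \<le> lead_exp (x j)) \<longleftrightarrow> hcoeff (x i) m \<noteq> 0" if i: "i \<in> S'" for i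
  proof
    assume "\<forall>j\<in>S'. lead_exp (x i) \<le> lead_exp (x j)"
    then have "lead_exp (x i) = m" using le[OF i] kS' by (metis order.antisym)
    then show "hcoeff (x i) m \<noteq> 0" using leading_coeff_nonzero[of "x i"] i by (simp add: S'_def leading_coeff_def)
  next
    assume "hcoeff (x i) m \<noteq> 0"
    then have "lead_exp (x i) = m" using i below by (auto simp: S'_def intro: lead_exp_eqI)
    then show "\<forall>j\<in>S'. lead_exp (x i) \<le> lead_exp (x j)" using le by simp
  qed
  have M: "formal_sum T (\<lambda>i. \<nu> (x i)) S = image_mset (\<lambda>i. \<nu> (x i)) (mset_set S')"
    using S by (simp add: formal_sum_eq_image_mset S'_def \<nu>_eq_None_iff)
  have "leading_part (formal_sum T (\<lambda>i. \<nu> (x i)) S)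
      = image_mset (\<lambda>i. fst (the (\<nu> (x i)))) (mset_set {i \<in> S'. \<forall>j\<in>S'. snd (the (\<nu> (x i))) \<le> snd (the (\<nu> (x j)))})"
    unfolding leading_part_def M filter_mset_image_mset multiset.map_comp
    using fin by (simp add: filter_mset_mset_set comp_def)
  also have "{i \<in> S'. \<forall>j\<in>S'. snd (the (\<nu> (x i))) \<le> snd (the (\<nu> (x j)))}
      = {i \<in> S'. \<forall>j\<in>S'. lead_exp (x i) \<le> lead_exp (x j)}"
    by (auto simp: \<nu> S'_def)
  also have "\<dots> = {i \<in> S'. hcoeff (x i) m \<noteq> 0}" using minimal by blast
  also have "\<dots> = {i \<in> S. \<phi> (hcoeff (x i) m) \<noteq> tzero F}" by (auto simp: S'_def \<phi>_eq_tzero_iff)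
  also have "image_mset (\<lambda>i. fst (the (\<nu> (x i)))) (mset_set {i \<in> S. \<phi> (hcoeff (x i) m) \<noteq> tzero F})
      = formal_sum F (\<lambda>i. \<phi> (hcoeff (x i) m)) S"
    unfolding formal_sum_eq_image_mset[OF S]
  proof (rule image_mset_cong)
    fix i assume "i \<in># mset_set {i \<in> S. \<phi> (hcoeff (x i) m) \<noteq> tzero F}"
    then have i: "i \<in> S" "hcoeff (x i) m \<noteq> 0" using S by (auto simp: \<phi>_eq_tzero_iff)
    then have "leading_coeff (x i) = hcoeff (x i) m" using below by (auto intro: lead_exp_eqI)
    then show "fst (the (\<nu> (x i))) = \<phi> (hcoeff (x i) m)" using i by (auto simp: \<nu>)
  qed
  finally have "leading_part (formal_sum T (\<lambda>i. \<nu> (x i)) S) = formal_sum F (\<lambda>i. \<phi> (hcoeff (x i) m)) S" .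
  moreover have "formal_sum T (\<lambda>i. \<nu> (x i)) S \<noteq> {#}"
    unfolding M using kS'(1) fin by (auto simp: mset_set_empty_iff)
  ultimately show ?thesis using null by (simp add: null_set_tropical_extension)
qed

text \<open>The lift is returned as a combination of the cocircuits of the sets
  \<open>B - {b}\<close>, since cocircuits of a contraction translate back to cocircuits of the
  original matroid.\<close>

lemma ex_covector_of_ones:
  assumes S: "S \<subseteq> E" and plucker: "signed_plucker S r \<alpha> \<beta> P"
    and null: "\<And>J. J \<subseteq> S \<Longrightarrow> card J = r + 1 \<Longrightarrow> formal_sum T (\<lambda>i. \<nu> (circ \<beta> P J i)) S \<in> null_set T"
  shows "\<exists>B c. B \<subseteq> S \<and> card B = r \<and>
    (\<forall>e\<in>S. \<nu> (\<Sum>b\<in>B. c b * cocirc \<alpha> P (B - {b}) e) = Some (\<one>\<^bsub>F\<^esub>, 0))"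
proof -
  interpret K: signed_plucker S r \<alpha> \<beta> P by fact
  define Bs where "Bs = {B. B \<subseteq> S \<and> card B = r \<and> P B \<noteq> 0}"
  have "finite (Pow S)" using K.finite_ground by simp
  then have fBs: "finite Bs" by (rule rev_finite_subset) (auto simp: Bs_def)
  have neBs: "Bs \<noteq> {}" using K.ex_basis by (auto simp: Bs_def)
  define m where "m = Min ((\<lambda>B. lead_exp (P B)) ` Bs)"
  have m_le: "m \<le> lead_exp (P B)" if "B \<in> Bs" for B using that fBs by (simp add: m_def)
  have "m \<in> (\<lambda>B. lead_exp (P B)) ` Bs" unfolding m_def using fBs neBs by (intro Min_in) auto
  then obtain B where B: "B \<in> Bs" "lead_exp (P B) = m" by blast
  have below: "hcoeff (P A) h = 0" if A: "A \<subseteq> S" "card A = r" "h < m" for A h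
  proof (cases "P A = 0")
    case False
    then have "h < lead_exp (P A)" using m_le[of A] A by (auto simp: Bs_def)
    then show ?thesis by (rule hcoeff_less_lead_exp)
  qed simp
  have fin: "finite A" if "A \<subseteq> S" for A using that K.finite_ground finite_subset by blast
  \<comment> \<open>The initial matroid: \<open>m\<close> is the least exponent among the Pluecker
    coordinates.\<close>
  define p where "p A = hcoeff (P A) m" for A
  have circ_p: "circ \<beta> p J i = hcoeff (circ \<beta> P J i) m" for J i
    by (simp add: circ_def p_def hcoeff_neg_one_power_times)
  have cocirc_p: "cocirc \<alpha> p I i = hcoeff (cocirc \<alpha> P I i) m" for I i
    by (simp add: cocirc_def p_def hcoeff_neg_one_power_times)
  have circ_below: "hcoeff (circ \<beta> P J i) h = 0" if "J \<subseteq> S" "card J = r + 1" "h < m" for J i h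
  proof -
    have "J - {i} \<subseteq> S" using that(1) by blast
    then show ?thesis
      using that below[of "J - {i}" h] fin[OF that(1)] by (simp add: circ_def hcoeff_neg_one_power_times)
  qed
  have cocirc_below: "hcoeff (cocirc \<alpha> P I i) h = 0" if "I \<subseteq> S" "card I + 1 = r" "h < m" "i \<in> S" for I i h
    using that below[of "insert i I" h] fin[OF that(1)] by (auto simp: cocirc_def hcoeff_neg_one_power_times)
  have BS: "B \<subseteq> S" "card B = r" and PB: "P B \<noteq> 0" using B by (auto simp: Bs_def)
  have fB: "finite B" using fin BS by blast
  have pB: "p B \<noteq> 0" using leading_coeff_nonzero[OF PB] B(2) by (simp add: p_def leading_coeff_def)
  interpret k: signed_plucker S r \<alpha> \<beta> p
  proof
    show "finite S" by (rule K.finite_ground)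
    show "\<exists>B\<subseteq>S. card B = r \<and> p B \<noteq> 0" using BS pB by blast
    fix I J assume I: "I \<subseteq> S" "card I + 1 = r" and J: "J \<subseteq> S" "card J = r + 1"
    \<comment> \<open>At exponent \<open>m + m\<close> a product sees only the coefficients at
      \<open>m\<close> of its factors, so this is the relation for \<open>p\<close>.\<close>
    have "0 = hcoeff (\<Sum>i\<in>S. circ \<beta> P J i * cocirc \<alpha> P I i) (m + m)"
      using K.circ_orthogonal_cocirc[OF I J] by simp
    also have "\<dots> = (\<Sum>i\<in>S. circ \<beta> p J i * cocirc \<alpha> p I i)"
      unfolding hcoeff_sum circ_p cocirc_p
      by (intro sum.cong refl hcoeff_times_lead) (use circ_below[OF J] cocirc_below[OF I] in auto)
    finally show "(\<Sum>i\<in>S. circ \<beta> p J i * cocirc \<alpha> p I i) = 0" by simp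
  qed
  have "formal_sum F (\<lambda>i. \<phi> (circ \<beta> p J i)) S \<in> null_set F" if J: "J \<subseteq> S" "card J = r + 1" for J
    unfolding circ_p using formal_sum_initial_null[OF K.finite_ground _ null[OF J]] circ_below[OF J] by blast
  then obtain a where a: "k.covector a" "\<And>i. i \<in> S \<Longrightarrow> \<phi> (a i) = \<one>\<^bsub>F\<^esub>"
    using lift[OF S k.signed_plucker_axioms] by blast
  \<comment> \<open>At \<open>b\<close> only the summand of \<open>b\<close> survives, since
    \<open>b\<close> lies in \<open>B - {b'}\<close> for every other \<open>b'\<close>; the division
    makes \<open>y b\<close> the constant series \<open>a b\<close>.\<close>
  define c where "c b = hmonom (a b) 0 / cocirc \<alpha> P (B - {b}) b" for b
  define y where "y e = (\<Sum>b\<in>B. c b * cocirc \<alpha> P (B - {b}) e)" for e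
  have cov: "K.covector y" unfolding y_def
  proof (intro K.covector_sum[OF fB] K.covector_scale K.covector_cocirc)
    fix b assume "b \<in> B"
    then show "B - {b} \<subseteq> S" "card (B - {b}) + 1 = r" using BS card_Suc_Diff1[OF fB] by auto
  qed
  have yB: "y b = hmonom (a b) 0" if b: "b \<in> B" for b
  proof -
    have "y b = (\<Sum>b'\<in>{b}. c b' * cocirc \<alpha> P (B - {b'}) b)" unfolding y_def
      by (rule sum.mono_neutral_right) (use fB b in \<open>auto simp: cocirc_def\<close>)
    also have "cocirc \<alpha> P (B - {b}) b \<noteq> 0" using b PB by (simp add: cocirc_def insert_absorb)
    then have "(\<Sum>b'\<in>{b}. c b' * cocirc \<alpha> P (B - {b'}) b) = hmonom (a b) 0" by (simp add: c_def)
    finally show ?thesis .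
  qed
  have y0: "(\<forall>h<0. hcoeff (y e) h = 0) \<and> hcoeff (y e) 0 = a e" if e: "e \<in> S" for e
  proof (cases "e \<in> B")
    case True
    then show ?thesis by (auto simp: yB hcoeff_hmonom)
  next
    case False
    \<comment> \<open>The fundamental circuit of \<open>e\<close> expresses \<open>y e\<close>
      through the entries on \<open>B\<close>. Its entry at \<open>e\<close> is \<open>P B\<close>
      up to sign and so starts exactly at \<open>m\<close>, before which no entry starts.\<close>
    define J where "J = insert e B"
    have J: "J \<subseteq> S" "card J = r + 1" using BS e False fB by (auto simp: J_def)
    note split = sum_circ_insert[OF K.finite_ground J(1)[unfolded J_def] False, folded J_def]
    let ?x = "circ \<beta> P J e" and ?R = "\<Sum>b\<in>B. circ \<beta> P J b * y b"
    have xy: "?x * y e = - ?R"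
      using cov J split[of \<beta> P y] by (simp add: K.covector_def eq_neg_iff_add_eq_0)
    have xa: "circ \<beta> p J e * a e = - (\<Sum>b\<in>B. circ \<beta> p J b * a b)"
      using a(1) J split[of \<beta> p a] by (simp add: k.covector_def eq_neg_iff_add_eq_0)
    have xm: "hcoeff ?x m \<noteq> 0"
      using pB False by (simp add: circ_def J_def p_def hcoeff_neg_one_power_times)
    then have xl: "lead_exp ?x = m" "?x \<noteq> 0" using circ_below[OF J] by (auto intro: lead_exp_eqI)
    have yb_below: "hcoeff (y b) h = 0" if "b \<in> B" "h < 0" for b h
      using that by (auto simp: yB hcoeff_hmonom)
    have R_below: "hcoeff ?R h = 0" if h: "h < m" for h
      unfolding hcoeff_sum
    proof (intro sum.neutral ballI)
      fix b assume "b \<in> B"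
      then show "hcoeff (circ \<beta> P J b * y b) h = 0"
        using hcoeff_times_below[of m "circ \<beta> P J b" 0 "y b" h] circ_below[OF J] yb_below h by simp
    qed
    have R_m: "hcoeff ?R m = (\<Sum>b\<in>B. circ \<beta> p J b * a b)"
      unfolding hcoeff_sum
    proof (rule sum.cong[OF refl])
      fix b assume b: "b \<in> B"
      then show "hcoeff (circ \<beta> P J b * y b) m = circ \<beta> p J b * a b"
        using hcoeff_times_lead[of m "circ \<beta> P J b" 0 "y b"] circ_below[OF J] yb_below
        by (simp add: circ_p yB hcoeff_hmonom)
    qed
    \<comment> \<open>The product \<open>?x * y e\<close> starts at
      \<open>m + lead_exp (y e)\<close> and equals \<open>- ?R\<close>, which has nothing below
      \<open>m\<close>.\<close>
    have y_below: "hcoeff (y e) h = 0" if "h < 0" for h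
    proof (cases "y e = 0")
      case False
      have "hcoeff (?x * y e) (m + lead_exp (y e)) \<noteq> 0"
        using leading_coeff_nonzero[OF hahn_times_nonzero[OF xl(2) False]] lead_exp_times[OF xl(2) False] xl(1)
        by (simp add: leading_coeff_def)
      then have "\<not> m + lead_exp (y e) < m" using R_below unfolding xy by auto
      then have "h < lead_exp (y e)" using that by (simp add: not_less)
      then show ?thesis by (rule hcoeff_less_lead_exp)
    qed simp
    \<comment> \<open>At exponent \<open>m\<close> the equation for \<open>y e\<close> becomes the
      one that \<open>a e\<close> satisfies over the residue field.\<close>
    have "hcoeff ?x m * hcoeff (y e) 0 = hcoeff (?x * y e) (m + 0)"
      by (rule hcoeff_times_lead[symmetric]) (use circ_below[OF J] y_below in auto)
    also have "\<dots> = hcoeff ?x m * a e" using R_m xa by (simp add: xy circ_p)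
    finally show ?thesis using xm y_below by simp
  qed
  have "\<nu> (y e) = Some (\<one>\<^bsub>F\<^esub>, 0)" if e: "e \<in> S" for e
  proof -
    have "\<phi> (a e) \<noteq> tzero F" using a(2)[OF e] F.tzero_notin F.one_closed by metis
    then have "hcoeff (y e) 0 \<noteq> 0" using y0[OF e] by (simp add: \<phi>_eq_tzero_iff)
    then show ?thesis using y0[OF e] lead_exp_eqI[of "y e" 0] a(2)[OF e] by (auto simp: \<nu>)
  qed
  then show ?thesis using BS unfolding y_def by blast
qed

end

section \<open>Reduction by contraction and rescaling\<close>

context liftable_valuation
begin

lemma tract_hom_\<nu>: "tract_hom field_tract T \<nu>"
  using enriched by (simp add: enriched_valuation_def)

lemma \<nu>_range: "range \<nu> = telems T"
  using enriched by (auto simp: enriched_valuation_def telems_def field_tract_def)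

lemma \<nu>_times: "x \<noteq> 0 \<Longrightarrow> y \<noteq> 0 \<Longrightarrow> \<nu> (x * y) = \<nu> x \<otimes>\<^bsub>T\<^esub> \<nu> y"
  using tract_hom_\<nu> by (simp add: tract_hom_def hom_def field_tract_def)

lemma \<nu>_nonzero: "x \<noteq> 0 \<Longrightarrow> \<nu> x \<in> carrier T"
  using tract_hom_\<nu> by (auto simp: tract_hom_def hom_def field_tract_def)

text \<open>The condition \<open>null\<close> tests the tuple of values of \<open>z\<close>.
  Contraction removes the zeros of \<open>z\<close> and rescaling by \<open>z\<close> turns the
  remaining values into ones, so \<open>ex_covector_of_ones\<close> applies.\<close>

lemma ex_covector_with_valuations:
  assumes plucker: "signed_plucker E r \<alpha> \<beta> P"
    and null: "\<And>J. J \<subseteq> E \<Longrightarrow> card J = r + 1 \<Longrightarrow>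
      formal_sum T (\<lambda>i. \<nu> (circ \<beta> P J i * z i)) E \<in> null_set T"
  shows "\<exists>y. signed_plucker.covector E r \<beta> P y \<and> (\<forall>i\<in>E. \<nu> (y i) = \<nu> (z i))"
proof -
  interpret K: signed_plucker E r \<alpha> \<beta> P by fact
  define S where "S = {i \<in> E. z i \<noteq> 0}"
  have SE: "S \<subseteq> E" and fS: "finite S" using finite_E by (auto simp: S_def)
  have fin: "finite A" if "A \<subseteq> E" for A using that finite_E finite_subset by blast
  obtain B0 where B0: "B0 \<subseteq> E" "card B0 = r" "P B0 \<noteq> 0"
    and max: "\<And>A. A \<subseteq> E \<Longrightarrow> card A = r \<Longrightarrow> P A \<noteq> 0 \<Longrightarrow> card (A - S) \<le> card (B0 - S)"
  proof -
    obtain B0 where "B0 \<subseteq> E \<and> card B0 = r \<and> P B0 \<noteq> 0" using K.ex_basis by blast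
    moreover have "\<forall>A. A \<subseteq> E \<and> card A = r \<and> P A \<noteq> 0 \<longrightarrow> card (A - S) < Suc (card E)"
      using finite_E by (auto simp: less_Suc_eq_le intro!: card_mono)
    ultimately show thesis
      using ex_has_greatest_nat[of "\<lambda>B. B \<subseteq> E \<and> card B = r \<and> P B \<noteq> 0" B0 "\<lambda>A. card (A - S)" "Suc (card E)"] that
      by auto
  qed
  \<comment> \<open>A maximal independent set of zeros of \<open>z\<close>, since \<open>B0\<close>
    has as many elements outside \<open>S\<close> as possible.\<close>
  define X where "X = B0 - S"
  define s where "s = card (B0 \<inter> S)"
  have X: "X \<subseteq> E" "X \<inter> S = {}" "finite X" using B0(1) fin by (auto simp: X_def)
  have "B0 = (B0 \<inter> S) \<union> X" by (auto simp: X_def)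
  then have r: "r = s + card X"
    using B0(2) fin[OF B0(1)] X card_Un_disjoint[of "B0 \<inter> S" X] by (auto simp: s_def)
  have cardX: "card (A \<union> X) = card A + card X" if "A \<subseteq> S" for A
    using that X fS finite_subset by (intro card_Un_disjoint) auto
  define D where "D A = prod z A" for A
  have D: "D A \<noteq> 0" if "A \<subseteq> S" for A
    using that finite_subset[OF that fS] by (auto simp: D_def S_def)
  \<comment> \<open>The contraction by \<open>X\<close>, restricted to \<open>S\<close> and
    rescaled: up to a common factor, circuit entries are multiplied and cocircuit entries divided by
    \<open>z i\<close>, as \<open>circ'\<close> and \<open>cocirc'\<close> record.\<close>
  define Q where "Q A = P (A \<union> X) / D A" for A
  define \<alpha>' where "\<alpha>' I = \<alpha> (I \<union> X)" for I
  define \<beta>' where "\<beta>' J = \<beta> (J \<union> X)" for J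
  have z: "z i \<noteq> 0" if "i \<in> S" for i using that by (simp add: S_def)
  have circ': "circ \<beta>' Q J i = circ \<beta> P (J \<union> X) i * z i / D J" if "J \<subseteq> S" "i \<in> S" for J i
  proof (cases "i \<in> J")
    case True
    have "J \<union> X - {i} = J - {i} \<union> X" using X that by blast
    moreover have "D J = z i * D (J - {i})"
      unfolding D_def using True that(1) fS finite_subset by (intro prod.remove) auto
    ultimately show ?thesis using True z[OF that(2)] by (simp add: circ_def Q_def \<beta>'_def)
  qed (use X that in \<open>auto simp: circ_def\<close>)
  have cocirc': "cocirc \<alpha>' Q I i * z i = cocirc \<alpha> P (I \<union> X) i / D I" if "I \<subseteq> S" "i \<in> S" for I i
  proof (cases "i \<in> I")
    case False
    have "D (insert i I) = z i * D I"
      unfolding D_def using False that(1) fS finite_subset by (intro prod.insert) auto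
    moreover have "i \<notin> X" using X that by blast
    ultimately show ?thesis using False z[OF that(2)] by (simp add: cocirc_def Q_def \<alpha>'_def)
  qed (simp add: cocirc_def)
  text \<open>Here the maximality of \<open>X\<close> is used.\<close>
  have cocirc_off: "cocirc \<alpha> P (I \<union> X) i = 0" if I: "I \<subseteq> S" "card I + 1 = s" and i: "i \<in> E - S" for I i
  proof (rule ccontr)
    assume *: "cocirc \<alpha> P (I \<union> X) i \<noteq> 0"
    then have i': "i \<notin> I \<union> X" "P (insert i (I \<union> X)) \<noteq> 0" by (auto simp: cocirc_def split: if_splits)
    have "finite (I \<union> X)" using I fS X finite_subset by blast
    then have "card (insert i (I \<union> X)) = r" using i' cardX[OF I(1)] I(2) r by simp
    moreover have "insert i (I \<union> X) \<subseteq> E" using I SE X i by blast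
    ultimately have "card (insert i (I \<union> X) - S) \<le> card X" using max i'(2) by (simp add: X_def)
    moreover have "insert i (I \<union> X) - S = insert i X" using I X i by blast
    ultimately show False using i' X by simp
  qed
  have Q: "signed_plucker S s \<alpha>' \<beta>' Q"
  proof
    show "finite S" by (rule fS)
    have "Q (B0 \<inter> S) \<noteq> 0" using B0(3) D[of "B0 \<inter> S"] \<open>B0 = (B0 \<inter> S) \<union> X\<close> by (simp add: Q_def)
    then show "\<exists>B\<subseteq>S. card B = s \<and> Q B \<noteq> 0" by (auto simp: s_def)
    fix I J assume I: "I \<subseteq> S" "card I + 1 = s" and J: "J \<subseteq> S" "card J = s + 1"
    have "(\<Sum>i\<in>S. circ \<beta>' Q J i * cocirc \<alpha>' Q I i)
        = (\<Sum>i\<in>S. circ \<beta> P (J \<union> X) i * cocirc \<alpha> P (I \<union> X) i / (D J * D I))"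
    proof (rule sum.cong[OF refl])
      fix i assume i: "i \<in> S"
      have "circ \<beta>' Q J i * cocirc \<alpha>' Q I i = circ \<beta> P (J \<union> X) i / D J * (cocirc \<alpha>' Q I i * z i)"
        using circ'[OF J(1) i] by simp
      then show "circ \<beta>' Q J i * cocirc \<alpha>' Q I i = circ \<beta> P (J \<union> X) i * cocirc \<alpha> P (I \<union> X) i / (D J * D I)"
        unfolding cocirc'[OF I(1) i] by simp
    qed
    \<comment> \<open>The cocircuit of \<open>I \<union> X\<close> vanishes off \<open>S\<close>, so
      the sum extends to \<open>E\<close>, where the relation for \<open>P\<close> applies.\<close>
    also have "\<dots> = (\<Sum>i\<in>E. circ \<beta> P (J \<union> X) i * cocirc \<alpha> P (I \<union> X) i / (D J * D I))"
      by (rule sum.mono_neutral_left) (use finite_E SE cocirc_off[OF I] in auto)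
    also have "\<dots> = (\<Sum>i\<in>E. circ \<beta> P (J \<union> X) i * cocirc \<alpha> P (I \<union> X) i) / (D J * D I)"
      by (rule sum_divide_distrib[symmetric])
    also have "\<dots> = 0"
      using K.circ_orthogonal_cocirc[of "I \<union> X" "J \<union> X"] cardX I J r SE X by simp
    finally show "(\<Sum>i\<in>S. circ \<beta>' Q J i * cocirc \<alpha>' Q I i) = 0" .
  qed
  have "formal_sum T (\<lambda>i. \<nu> (circ \<beta>' Q J i)) S \<in> null_set T" if J: "J \<subseteq> S" "card J = s + 1" for J
  proof -
    \<comment> \<open>The test sum for \<open>J\<close> on \<open>S\<close> is the one for
      \<open>J \<union> X\<close> on \<open>E\<close> scaled by the value of \<open>d\<close>;
      coordinates off \<open>S\<close> drop out because \<open>z\<close> vanishes there.\<close>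
    define d where "d = inverse (D J)"
    have d: "d \<noteq> 0" using D[OF J(1)] by (simp add: d_def)
    define x where "x i = circ \<beta> P (J \<union> X) i * z i" for i
    have eq: "circ \<beta>' Q J i = d * x i" if "i \<in> S" for i
      using circ'[OF J(1) that] by (simp add: d_def x_def divide_inverse mult.commute)
    have supp: "{i \<in> S. \<nu> (circ \<beta>' Q J i) \<noteq> tzero T} = {i \<in> E. \<nu> (x i) \<noteq> tzero T}"
    proof -
      have "{i \<in> S. \<nu> (circ \<beta>' Q J i) \<noteq> tzero T} = {i \<in> S. x i \<noteq> 0}"
        using d by (auto simp: \<nu>_eq_None_iff eq)
      also have "\<dots> = {i \<in> E. \<nu> (x i) \<noteq> tzero T}"
        by (auto simp: S_def x_def \<nu>_eq_None_iff)
      finally show ?thesis .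
    qed
    have "formal_sum T (\<lambda>i. \<nu> (circ \<beta>' Q J i)) S
        = image_mset (\<lambda>i. \<nu> d \<otimes>\<^bsub>T\<^esub> \<nu> (x i)) (mset_set {i \<in> E. \<nu> (x i) \<noteq> tzero T})"
      unfolding formal_sum_eq_image_mset[OF fS] supp
    proof (rule image_mset_cong)
      fix i assume "i \<in># mset_set {i \<in> E. \<nu> (x i) \<noteq> tzero T}"
      then have "i \<in> E" "x i \<noteq> 0" using finite_E by (auto simp: \<nu>_eq_None_iff)
      moreover from this have "i \<in> S" by (auto simp: S_def x_def)
      ultimately show "\<nu> (circ \<beta>' Q J i) = \<nu> d \<otimes>\<^bsub>T\<^esub> \<nu> (x i)" using eq \<nu>_times[OF d] by simp
    qed
    also have "\<dots> = image_mset (\<lambda>a. \<nu> d \<otimes>\<^bsub>T\<^esub> a) (formal_sum T (\<lambda>i. \<nu> (x i)) E)"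
      by (simp add: formal_sum_eq_image_mset[OF finite_E] multiset.map_comp comp_def)
    also have "\<dots> \<in> null_set T"
    proof (rule T.null_scale)
      show "formal_sum T (\<lambda>i. \<nu> (x i)) E \<in> null_set T"
        unfolding x_def using J SE X cardX r by (intro null) auto
    qed (rule \<nu>_nonzero[OF d])
    finally show ?thesis .
  qed
  then obtain B c where B: "B \<subseteq> S" "card B = s"
    and one: "\<And>e. e \<in> S \<Longrightarrow> \<nu> (\<Sum>b\<in>B. c b * cocirc \<alpha>' Q (B - {b}) e) = Some (\<one>\<^bsub>F\<^esub>, 0)"
    using ex_covector_of_ones[OF SE Q] by blast
  have fB: "finite B" using B fS finite_subset by blast
  have Bb: "B - {b} \<subseteq> S" "card (B - {b}) + 1 = s" if "b \<in> B" for b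
    using B card_Suc_Diff1[OF fB that] by auto
  have BbX: "B - {b} \<union> X \<subseteq> E" "card (B - {b} \<union> X) + 1 = r" if b: "b \<in> B" for b
    using Bb[OF b] cardX[OF Bb(1)[OF b]] r SE X(1) by auto
  \<comment> \<open>The same combination, with cocircuits of \<open>P\<close> in place of those of
    \<open>Q\<close>: on \<open>S\<close> it is \<open>z e\<close> times an element of value one,
    and off \<open>S\<close> it is zero by \<open>cocirc_off\<close>.\<close>
  define y where "y e = (\<Sum>b\<in>B. c b / D (B - {b}) * cocirc \<alpha> P (B - {b} \<union> X) e)" for e
  have "K.covector y" unfolding y_def
    by (intro K.covector_sum[OF fB] K.covector_scale K.covector_cocirc BbX)
  moreover have "\<nu> (y e) = \<nu> (z e)" if e: "e \<in> E" for e
  proof (cases "e \<in> S")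
    case True
    let ?w = "\<Sum>b\<in>B. c b * cocirc \<alpha>' Q (B - {b}) e"
    have "y e = ?w * z e"
      unfolding y_def sum_distrib_right
      by (intro sum.cong refl) (simp add: mult.assoc cocirc'[OF Bb(1) True])
    moreover have "\<nu> ?w \<noteq> None" unfolding one[OF True] by simp
    then have "?w \<noteq> 0" unfolding \<nu>_eq_None_iff .
    ultimately have "\<nu> (y e) = \<one>\<^bsub>T\<^esub> \<otimes>\<^bsub>T\<^esub> \<nu> (z e)"
      using \<nu>_times[of ?w "z e"] one[OF True] z[OF True] by simp
    then show ?thesis using T.l_one[OF \<nu>_nonzero[OF z[OF True]]] by simp
  next
    case False
    then have "y e = 0" unfolding y_def using cocirc_off[OF Bb] e by (intro sum.neutral) auto
    then show ?thesis using False e by (simp add: S_def)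
  qed
  ultimately show ?thesis by blast
qed

end

section \<open>Covectors in terms of a single Pluecker vector\<close>

context tract
begin

lemma tmult_closed: "a \<in> telems T \<Longrightarrow> b \<in> telems T \<Longrightarrow> tmult T a b \<in> telems T"
  by (auto simp: telems_def tmult_def)

lemma tmult_eq_tzero_iff:
  "a \<in> telems T \<Longrightarrow> b \<in> telems T \<Longrightarrow> tmult T a b = tzero T \<longleftrightarrow> a = tzero T \<or> b = tzero T"
  using tzero_notin by (auto simp: telems_def tmult_def) (metis m_closed)+

lemma tmult_assoc:
  assumes "a \<in> telems T" "b \<in> telems T" "c \<in> telems T"
  shows "tmult T (tmult T a b) c = tmult T a (tmult T b c)"
proof (cases "a = tzero T \<or> b = tzero T \<or> c = tzero T")
  case True
  then show ?thesis by (auto simp: tmult_def)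
next
  case False
  moreover have "a \<otimes> b \<noteq> tzero T" "b \<otimes> c \<noteq> tzero T"
    using False assms tzero_notin unfolding telems_def by (metis insertE m_closed)+
  ultimately show ?thesis using assms by (simp add: tmult_def telems_def m_assoc)
qed

lemma tmult_commute: "a \<in> telems T \<Longrightarrow> b \<in> telems T \<Longrightarrow> tmult T a b = tmult T b a"
  by (auto simp: telems_def tmult_def m_comm)

lemma tmult_left_commute:
  "a \<in> telems T \<Longrightarrow> b \<in> telems T \<Longrightarrow> c \<in> telems T \<Longrightarrow> tmult T a (tmult T b c) = tmult T b (tmult T a c)"
  using tmult_assoc[of a b c] tmult_assoc[of b a c] tmult_commute[of a b] by simp

lemma tmult_carrier: "a \<in> carrier T \<Longrightarrow> b \<in> carrier T \<Longrightarrow> tmult T a b \<in> carrier T"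
  using tzero_notin by (auto simp: tmult_def)

lemma carrier_telems: "a \<in> carrier T \<Longrightarrow> a \<in> telems T"
  by (simp add: telems_def)

lemma tneg_one: "tneg_one T \<in> carrier T" "{#\<one>, tneg_one T#} \<in> null_set T"
  using theI'[OF ex1_neg] by (simp_all add: tneg_one_def)

lemma tneg_one_eqI: "e \<in> carrier T \<Longrightarrow> {#\<one>, e#} \<in> null_set T \<Longrightarrow> tneg_one T = e"
  using ex1_neg tneg_one by blast

lemma formal_sum_tmult:
  assumes c: "c \<in> carrier T" and A: "finite A" and f: "\<And>i. i \<in> A \<Longrightarrow> f i \<in> telems T"
  shows "formal_sum T (\<lambda>i. tmult T c (f i)) A = image_mset (\<lambda>a. c \<otimes> a) (formal_sum T f A)"
proof -
  have c0: "c \<noteq> tzero T" using c tzero_notin by metis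
  have supp: "{i \<in> A. tmult T c (f i) \<noteq> tzero T} = {i \<in> A. f i \<noteq> tzero T}"
    using tmult_eq_tzero_iff[OF carrier_telems[OF c] f] c0 by blast
  show ?thesis
    unfolding formal_sum_eq_image_mset[OF A] supp multiset.map_comp
    by (rule image_mset_cong) (use A c0 in \<open>auto simp: tmult_def\<close>)
qed

lemma circuit_vector_closed:
  assumes "finite E" "P \<in> nsets E r \<rightarrow>\<^sub>E telems T" "t \<in> nsets E (r + 1)" "i \<in> E"
  shows "circuit_vector T E P t i \<in> telems T"
proof (cases "i \<in> t")
  case True
  then have "t - {i} \<in> nsets E r" using assms(3) by (auto simp: nsets_def)
  then have "P (t - {i}) \<in> telems T" using assms(2) by blast
  then show ?thesis using True assms(4) tneg_one(1)
    by (simp add: circuit_vector_def tmult_closed carrier_telems)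
qed (use assms(4) in \<open>simp add: circuit_vector_def telems_def\<close>)

text \<open>All members of \<open>M\<close> are multiples of \<open>P\<close>, so every circuit is a
  multiple of a circuit vector of \<open>P\<close>, and null sets are stable under scaling. Sets
  \<open>t\<close> whose circuit vector is zero may be included because their formal sum is
  empty.\<close>

lemma covectors_eq:
  assumes E: "finite E" and P: "P \<in> nsets E r \<rightarrow>\<^sub>E telems T" "P \<in> M"
    and M: "\<And>Q. Q \<in> M \<Longrightarrow> \<exists>d\<in>carrier T. \<forall>A\<in>nsets E r. Q A = tmult T d (P A)"
    and \<sigma>: "\<And>a. a \<in> telems T \<Longrightarrow> \<sigma> a \<in> telems T"
  shows "covectors T \<sigma> E r M = {Y \<in> E \<rightarrow>\<^sub>E telems T. \<forall>t\<in>nsets E (r + 1).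
    formal_sum T (\<lambda>i. tmult T (circuit_vector T E P t i) (\<sigma> (Y i))) E \<in> null_set T}"
proof -
  have "(\<forall>C\<in>circuits T E r M. formal_sum T (\<lambda>i. tmult T (C i) (\<sigma> (Y i))) E \<in> null_set T) \<longleftrightarrow>
      (\<forall>t\<in>nsets E (r + 1). formal_sum T (\<lambda>i. tmult T (circuit_vector T E P t i) (\<sigma> (Y i))) E \<in> null_set T)"
    (is "?L \<longleftrightarrow> ?R") if Y: "Y \<in> E \<rightarrow>\<^sub>E telems T" for Y
  proof
    assume L: ?L
    show ?R
    proof
      fix t assume t: "t \<in> nsets E (r + 1)"
      let ?v = "circuit_vector T E P t"
      show "formal_sum T (\<lambda>i. tmult T (?v i) (\<sigma> (Y i))) E \<in> null_set T"
      proof (cases "\<exists>i\<in>E. ?v i \<noteq> tzero T")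
        case True
        then have "(\<lambda>i\<in>E. tmult T \<one> (?v i)) \<in> circuits T E r M"
          unfolding circuits_def using P(2) t one_closed by blast
        then have "formal_sum T (\<lambda>i. tmult T ((\<lambda>i\<in>E. tmult T \<one> (?v i)) i) (\<sigma> (Y i))) E \<in> null_set T"
          using L by blast
        also have "formal_sum T (\<lambda>i. tmult T ((\<lambda>i\<in>E. tmult T \<one> (?v i)) i) (\<sigma> (Y i))) E
            = formal_sum T (\<lambda>i. tmult T (?v i) (\<sigma> (Y i))) E"
          unfolding formal_sum_def
        proof (intro arg_cong[where f = "filter_mset _"] image_mset_cong)
          fix i assume "i \<in># mset_set E"
          then have i: "i \<in> E" using E by simp
          have "\<one> \<noteq> tzero T" using tzero_notin one_closed by metis
          then have "tmult T \<one> (?v i) = ?v i"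
            using circuit_vector_closed[OF E P(1) t i] by (auto simp: tmult_def telems_def)
          then show "tmult T ((\<lambda>i\<in>E. tmult T \<one> (?v i)) i) (\<sigma> (Y i)) = tmult T (?v i) (\<sigma> (Y i))"
            using i by simp
        qed
        finally show ?thesis .
      next
        case False
        then have "{i \<in> E. tmult T (?v i) (\<sigma> (Y i)) \<noteq> tzero T} = {}" by (auto simp: tmult_def)
        then show ?thesis unfolding formal_sum_eq_image_mset[OF E] by (simp only:) (simp add: empty_null)
      qed
    qed
  next
    assume R: ?R
    show ?L
    proof
      fix C assume "C \<in> circuits T E r M"
      then obtain c Q t where C: "C = (\<lambda>i\<in>E. tmult T c (circuit_vector T E Q t i))"
        "c \<in> carrier T" "Q \<in> M" "t \<in> nsets E (r + 1)"
        unfolding circuits_def by blast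
      obtain d where d: "d \<in> carrier T" "\<And>A. A \<in> nsets E r \<Longrightarrow> Q A = tmult T d (P A)" using M[OF C(3)] by blast
      let ?v = "circuit_vector T E P t"
      have Qv: "circuit_vector T E Q t i = tmult T d (?v i)" if i: "i \<in> E" for i
      proof (cases "i \<in> t")
        case True
        let ?n = "tneg_one T [^] card {j \<in> t. j < i}"
        have t: "t - {i} \<in> nsets E r" using C(4) True by (auto simp: nsets_def)
        then have closed: "?n \<in> telems T" "d \<in> telems T" "P (t - {i}) \<in> telems T"
          using P(1) d(1) tneg_one(1) by (auto simp: carrier_telems)
        have "tmult T ?n (tmult T d (P (t - {i}))) = tmult T d (tmult T ?n (P (t - {i})))"
          using closed by (rule tmult_left_commute)
        then show ?thesis using True i d(2)[OF t] by (simp add: circuit_vector_def)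
      next
        case False
        then show ?thesis using i by (simp add: circuit_vector_def tmult_def)
      qed
      have Yi: "\<sigma> (Y i) \<in> telems T" if "i \<in> E" for i using \<sigma> Y that by blast
      have "formal_sum T (\<lambda>i. tmult T (C i) (\<sigma> (Y i))) E
          = formal_sum T (\<lambda>i. tmult T (tmult T c d) (tmult T (?v i) (\<sigma> (Y i)))) E"
        unfolding formal_sum_def
      proof (intro arg_cong[where f = "filter_mset _"] image_mset_cong)
        fix i assume "i \<in># mset_set E"
        then have i: "i \<in> E" using E by simp
        note cl = carrier_telems[OF C(2)] carrier_telems[OF d(1)] circuit_vector_closed[OF E P(1) C(4) i] Yi[OF i]
        show "tmult T (C i) (\<sigma> (Y i)) = tmult T (tmult T c d) (tmult T (?v i) (\<sigma> (Y i)))"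
          using i cl by (simp add: C(1) Qv tmult_assoc tmult_closed)
      qed
      also have "\<dots> = image_mset (\<lambda>a. tmult T c d \<otimes> a) (formal_sum T (\<lambda>i. tmult T (?v i) (\<sigma> (Y i))) E)"
        by (rule formal_sum_tmult[OF tmult_carrier[OF C(2) d(1)] E])
          (intro tmult_closed circuit_vector_closed[OF E P(1) C(4)] Yi)
      also have "\<dots> \<in> null_set T"
        using R C(4) by (intro null_scale tmult_carrier C d) auto
      finally show "formal_sum T (\<lambda>i. tmult T (C i) (\<sigma> (Y i))) E \<in> null_set T" .
    qed
  qed
  then show ?thesis unfolding covectors_def by blast
qed

end

section \<open>The tract of a field in ordinary field arithmetic\<close>

lemma field_tract_simps [simp]:
  "carrier field_tract = {a. a \<noteq> 0}" "a \<otimes>\<^bsub>field_tract\<^esub> b = a * b" "\<one>\<^bsub>field_tract\<^esub> = 1" "tzero field_tract = 0"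
  "telems field_tract = UNIV" "tmult field_tract a b = a * b"
  by (auto simp: field_tract_def telems_def tmult_def)

lemma field_tract_nat_pow: "a [^]\<^bsub>field_tract\<^esub> (n :: nat) = a ^ n"
proof -
  interpret tract "field_tract :: 'a tract" by (rule tract_field_tract)
  show ?thesis by (induction n) (simp_all add: mult.commute)
qed

lemma tneg_one_field_tract: "tneg_one field_tract = - 1"
  by (rule tract.tneg_one_eqI[OF tract_field_tract]) (simp_all, simp add: field_tract_def)

lemma formal_sum_field_tract_null_iff:
  assumes "finite A"
  shows "formal_sum field_tract f A \<in> null_set field_tract \<longleftrightarrow> sum f A = 0"
proof -
  have "sum_mset (formal_sum field_tract f A) = (\<Sum>i\<in>{i \<in> A. f i \<noteq> 0}. f i)"
    using assms by (simp add: formal_sum_eq_image_mset sum_unfold_sum_mset)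
  also have "\<dots> = sum f A"
    using assms by (intro sum.mono_neutral_left) auto
  finally have "sum_mset (formal_sum field_tract f A) = sum f A" .
  moreover have "0 \<notin># formal_sum field_tract f A" by (simp add: formal_sum_def)
  ultimately show ?thesis by (simp add: field_tract_def)
qed

lemma circuit_vector_field_tract:
  "i \<in> E \<Longrightarrow> circuit_vector field_tract E P t i = circ (\<lambda>J j. card {j' \<in> J. j' < j}) P t i"
  by (simp add: circuit_vector_def circ_def tneg_one_field_tract field_tract_nat_pow)

lemma plucker_vector_signed_plucker:
  fixes P :: "'e::linorder set \<Rightarrow> 'k::field"
  assumes E: "finite E" and r: "1 \<le> r" and P: "P \<in> plucker_vectors field_tract E r"
  shows "signed_plucker E r (\<lambda>I j. card {i \<in> I. j < i}) (\<lambda>J j. card {j' \<in> J. j' < j}) P"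
proof
  show "finite E" by fact
  show "\<exists>B\<subseteq>E. card B = r \<and> P B \<noteq> 0" using P by (auto simp: plucker_vectors_def nsets_def)
  let ?\<alpha> = "\<lambda>I j. card {i \<in> I. j < i}" and ?\<beta> = "\<lambda>J j. card {j' \<in> J. j' < j}"
  fix I J assume I: "I \<subseteq> E" "card I + 1 = r" and J: "J \<subseteq> E" "card J = r + 1"
  have fJ: "finite J" using J E finite_subset by blast
  have "I \<in> nsets E (r - 1)" "J \<in> nsets E (r + 1)"
    using I J E finite_subset by (auto simp: nsets_def)
  then have "formal_sum field_tract (\<lambda>j. exchange_sign field_tract j I J * (P (insert j I) * P (J - {j}))) (J - I)
      \<in> null_set field_tract"
    using P unfolding plucker_vectors_def by simp
  then have "(\<Sum>j\<in>J - I. exchange_sign field_tract j I J * (P (insert j I) * P (J - {j}))) = 0"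
    using fJ by (simp add: formal_sum_field_tract_null_iff)
  \<comment> \<open>The relations count the elements of \<open>J\<close> above \<open>j\<close>,
    circuits those below. The two counts add up to \<open>r\<close>, as \<open>J\<close> has
    \<open>r + 1\<close> elements including \<open>j\<close>, so this factor converts one convention
    into the other.\<close>
  then have "0 = (- 1) ^ r * (\<Sum>j\<in>J - I. (- 1) ^ (card {j' \<in> J. j < j'} + ?\<alpha> I j) * (P (insert j I) * P (J - {j})))"
    by (simp add: exchange_sign_def tneg_one_field_tract field_tract_nat_pow)
  also have "\<dots> = (\<Sum>j\<in>J - I. circ ?\<beta> P J j * cocirc ?\<alpha> P I j)"
    unfolding sum_distrib_left
  proof (rule sum.cong[OF refl])
    fix j assume j: "j \<in> J - I"
    have "J = insert j ({j' \<in> J. j < j'} \<union> {j' \<in> J. j' < j})" using j by auto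
    then have "card J = Suc (card ({j' \<in> J. j < j'} \<union> {j' \<in> J. j' < j}))"
      using fJ by (metis (no_types, lifting) card_insert_disjoint UnE finite_subset less_irrefl mem_Collect_eq subset_insertI)
    also have "card ({j' \<in> J. j < j'} \<union> {j' \<in> J. j' < j}) = card {j' \<in> J. j < j'} + ?\<beta> J j"
      using fJ by (intro card_Un_disjoint) auto
    finally have "r = card {j' \<in> J. j < j'} + ?\<beta> J j" using J by simp
    then have "(- 1 :: 'k) ^ r * (- 1) ^ (card {j' \<in> J. j < j'} + ?\<alpha> I j) = (- 1) ^ ?\<beta> J j * (- 1) ^ ?\<alpha> I j"
      by (simp add: power_add mult_ac flip: power_mult_distrib)
    then show "(- 1) ^ r * ((- 1) ^ (card {j' \<in> J. j < j'} + ?\<alpha> I j) * (P (insert j I) * P (J - {j})))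
        = circ ?\<beta> P J j * cocirc ?\<alpha> P I j"
      using j by (simp add: circ_def cocirc_def mult_ac)
  qed
  also have "\<dots> = (\<Sum>j\<in>E. circ ?\<beta> P J j * cocirc ?\<alpha> P I j)"
    by (rule sum.mono_neutral_left) (use E J in \<open>auto simp: circ_def cocirc_def\<close>)
  finally show "(\<Sum>j\<in>E. circ ?\<beta> P J j * cocirc ?\<alpha> P I j) = 0" by simp
qed

section \<open>Push-forward along the valuation\<close>

context liftable_valuation
begin

lemma \<nu>_tmult: "\<nu> (x * y) = tmult T (\<nu> x) (\<nu> y)"
proof (cases "x = 0 \<or> y = 0")
  case True
  then show ?thesis by (auto simp: tmult_def \<nu>)
next
  case False
  then show ?thesis using \<nu>_times by (simp add: tmult_def \<nu>_eq_None_iff)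
qed

lemma \<nu>_null:
  assumes "finite A" "sum x A = 0"
  shows "formal_sum T (\<lambda>i. \<nu> (x i)) A \<in> null_set T"
proof -
  have "formal_sum T (\<lambda>i. \<nu> (x i)) A = image_mset \<nu> (formal_sum field_tract x A)"
    by (simp add: formal_sum_eq_image_mset[OF assms(1)] multiset.map_comp comp_def \<nu>_eq_None_iff)
  moreover have "formal_sum field_tract x A \<in> null_set field_tract"
    using assms by (simp add: formal_sum_field_tract_null_iff)
  ultimately show ?thesis using tract_hom_\<nu> by (simp add: tract_hom_def)
qed

lemma \<nu>_one: "\<nu> 1 = \<one>\<^bsub>T\<^esub>"
proof -
  have "\<nu> 1 \<otimes>\<^bsub>T\<^esub> \<nu> 1 = \<nu> 1" using \<nu>_times[of 1 1] by simp
  then show ?thesis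
    using T.l_cancel_one[OF \<nu>_nonzero[of 1] \<nu>_nonzero[of 1]] by (simp del: tropical_extension_simps)
qed

lemma \<nu>_minus_one: "\<nu> (- 1) = tneg_one T"
proof (rule T.tneg_one_eqI[symmetric])
  have "{#1, - 1#} \<in> null_set (field_tract :: ('f, 'g) hahn tract)" by (simp add: field_tract_def)
  then have "image_mset \<nu> {#1, - 1#} \<in> null_set T" using tract_hom_\<nu> unfolding tract_hom_def by blast
  then show "{#\<one>\<^bsub>T\<^esub>, \<nu> (- 1)#} \<in> null_set T" by (simp add: \<nu>_one del: tropical_extension_simps)
qed (rule \<nu>_nonzero, simp)

lemma \<nu>_neg_one_power: "\<nu> ((- 1) ^ n) = tneg_one T [^]\<^bsub>T\<^esub> n"
proof (induction n)
  case (Suc n)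
  have "\<nu> ((- 1) ^ Suc n) = \<nu> ((- 1) ^ n) \<otimes>\<^bsub>T\<^esub> \<nu> (- 1)"
    using \<nu>_times[of "(- 1) ^ n" "- 1"] by (simp only: power_Suc2) simp
  then show ?case by (simp only: Suc.IH \<nu>_minus_one T.nat_pow_Suc)
qed (simp only: power_0 \<nu>_one T.nat_pow_0)

end

text \<open>The locale is a premise because its ground set carries no order, while the signs of a
  circuit vector refer to one.\<close>

lemma circuit_vector_pushforward:
  assumes "liftable_valuation F \<phi> \<nu> (E :: 'e::linorder set)" "t \<in> nsets E (r + 1)" "i \<in> E"
  shows "circuit_vector (tropical_extension F) E (\<lambda>A\<in>nsets E r. \<nu> (P A)) t i
    = \<nu> (circ (\<lambda>J j. card {j' \<in> J. j' < j}) P t i)"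
proof -
  interpret liftable_valuation F \<phi> \<nu> E by fact
  show ?thesis
  proof (cases "i \<in> t")
    case True
    then have "t - {i} \<in> nsets E r" using assms(2) by (auto simp: nsets_def)
    then show ?thesis using True assms(3)
      by (simp add: circuit_vector_def circ_def \<nu>_tmult \<nu>_neg_one_power)
  qed (use assms(3) in \<open>simp add: circuit_vector_def circ_def \<nu>\<close>)
qed

lemma plucker_vector_pushforward:
  assumes "liftable_valuation F \<phi> \<nu> (E :: 'e::linorder set)" "1 \<le> r" "P \<in> plucker_vectors field_tract E r"
  shows "(\<lambda>A\<in>nsets E r. \<nu> (P A)) \<in> plucker_vectors (tropical_extension F) E r"
proof -
  interpret liftable_valuation F \<phi> \<nu> E by fact
  let ?\<nu>P = "\<lambda>A\<in>nsets E r. \<nu> (P A)"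
  have "?\<nu>P \<in> nsets E r \<rightarrow>\<^sub>E telems T" using \<nu>_range by auto
  moreover obtain B where "B \<in> nsets E r" "P B \<noteq> 0" using assms(3) by (auto simp: plucker_vectors_def)
  then have "\<exists>B\<in>nsets E r. ?\<nu>P B \<noteq> tzero T" using \<nu>_eq_None_iff by force
  moreover have "formal_sum T (\<lambda>j. tmult T (exchange_sign T j I J) (tmult T (?\<nu>P (insert j I)) (?\<nu>P (J - {j})))) (J - I)
      \<in> null_set T" if I: "I \<in> nsets E (r - 1)" and J: "J \<in> nsets E (r + 1)" for I J
  proof -
    define x where "x j = exchange_sign field_tract j I J * (P (insert j I) * P (J - {j}))" for j
    have fin: "finite (J - I)" using J by (simp add: nsets_def)
    have "formal_sum field_tract x (J - I) \<in> null_set field_tract"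
      using assms(3) I J unfolding plucker_vectors_def x_def by simp
    then have "formal_sum T (\<lambda>j. \<nu> (x j)) (J - I) \<in> null_set T"
      using \<nu>_null[OF fin] formal_sum_field_tract_null_iff[OF fin, of x] by blast
    also have "formal_sum T (\<lambda>j. \<nu> (x j)) (J - I)
        = formal_sum T (\<lambda>j. tmult T (exchange_sign T j I J) (tmult T (?\<nu>P (insert j I)) (?\<nu>P (J - {j})))) (J - I)"
      unfolding formal_sum_def
    proof (intro arg_cong[where f = "filter_mset _"] image_mset_cong)
      fix j assume "j \<in># mset_set (J - I)"
      then have j: "j \<in> J" "j \<notin> I" using fin by auto
      have "insert j I \<in> nsets E r" "J - {j} \<in> nsets E r"
        using I J j \<open>1 \<le> r\<close> by (auto simp: nsets_def)
      then show "\<nu> (x j) = tmult T (exchange_sign T j I J) (tmult T (?\<nu>P (insert j I)) (?\<nu>P (J - {j})))"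
        by (simp add: x_def \<nu>_tmult exchange_sign_def tneg_one_field_tract field_tract_nat_pow \<nu>_neg_one_power)
    qed
    finally show ?thesis .
  qed
  ultimately show ?thesis by (simp add: plucker_vectors_def)
qed

text \<open>Compatibility moves the involutions through \<open>\<nu>\<close>: to lift a covector
  \<open>Z\<close> of the push-forward, the tuple of the \<open>\<tau> (Z i)\<close> is lifted to a
  vector orthogonal to the circuits, and \<open>\<sigma>\<close> is applied to the result.\<close>

theorem valuation_covectors:
  assumes lv: "liftable_valuation F \<phi> \<nu> (E :: 'e::linorder set)" and r: "1 \<le> r"
    and N: "N \<in> matroids field_tract E r"
    and comp: "compatible_involutions field_tract (tropical_extension F) \<nu> \<sigma> \<tau>"
  shows "(\<lambda>Y. \<lambda>i\<in>E. \<nu> (Y i)) ` covectors field_tract \<sigma> E r N =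
    covectors (tropical_extension F) \<tau> E r (pushforward (tropical_extension F) \<nu> E r N)"
proof -
  interpret liftable_valuation F \<phi> \<nu> E by fact
  obtain P where P: "P \<in> plucker_vectors field_tract E r" and N_eq: "N = scaling_rel field_tract E r `` {P}"
    using N unfolding matroids_def by (rule quotientE)
  define \<nu>P where "\<nu>P = (\<lambda>A\<in>nsets E r. \<nu> (P A))"
  let ?\<beta> = "\<lambda>J j. card {j' \<in> J. j' < j}"
  have PE: "P \<in> nsets E r \<rightarrow>\<^sub>E UNIV" using P by (simp add: plucker_vectors_def)
  have \<nu>P: "\<nu>P \<in> plucker_vectors T E r"
    unfolding \<nu>P_def by (rule plucker_vector_pushforward[OF lv r P])
  then have \<nu>PE: "\<nu>P \<in> nsets E r \<rightarrow>\<^sub>E telems T" by (simp add: plucker_vectors_def)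
  have scaled: "\<exists>c. c \<noteq> 0 \<and> (\<forall>A\<in>nsets E r. Q A = c * P A)" if "Q \<in> N" for Q
    using that unfolding N_eq scaling_rel_def by auto
  have "P = (\<lambda>A\<in>nsets E r. tmult field_tract 1 (P A))"
    using PiE_arb[OF PE] by (auto simp: restrict_def)
  then have "(P, P) \<in> scaling_rel field_tract E r" unfolding scaling_rel_def
    by (intro CollectI case_prodI conjI bexI[of _ 1] P) auto
  then have PN: "P \<in> N" unfolding N_eq by blast
  have one_scale: "\<nu>P = (\<lambda>A\<in>nsets E r. tmult T \<one>\<^bsub>T\<^esub> (\<nu>P A))"
  proof (rule ext)
    fix A show "\<nu>P A = (\<lambda>A\<in>nsets E r. tmult T \<one>\<^bsub>T\<^esub> (\<nu>P A)) A"
      using \<nu>_tmult[of 1 "P A"] by (simp add: \<nu>P_def \<nu>_one del: tropical_extension_simps)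
  qed
  have "(\<nu>P, \<nu>P) \<in> scaling_rel T E r"
    using \<nu>P one_scale T.one_closed unfolding scaling_rel_def by blast
  then have \<nu>P_in: "\<nu>P \<in> pushforward T \<nu> E r N"
    using PN unfolding pushforward_def \<nu>P_def by blast
  have \<sigma>: "\<sigma> (\<sigma> x) = x" "\<nu> (\<sigma> x) = \<tau> (\<nu> x)" for x
    using comp by (auto simp: compatible_involutions_def tract_involution_def)
  have \<tau>: "\<tau> (\<tau> a) = a" if "a \<in> telems T" for a
    using comp that by (auto simp: compatible_involutions_def tract_involution_def)
  have \<tau>_closed: "\<tau> a \<in> telems T" if "a \<in> telems T" for a
  proof -
    obtain x where "a = \<nu> x" using \<open>a \<in> telems T\<close> unfolding \<nu>_range[symmetric] by blast
    then have "\<tau> a = \<nu> (\<sigma> x)" by (simp add: \<sigma>(2))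
    then show ?thesis unfolding \<nu>_range[symmetric] by blast
  qed
  have covN: "covectors field_tract \<sigma> E r N = {Y \<in> E \<rightarrow>\<^sub>E UNIV. \<forall>t\<in>nsets E (r + 1).
      (\<Sum>i\<in>E. circ ?\<beta> P t i * \<sigma> (Y i)) = 0}"
  proof -
    have "covectors field_tract \<sigma> E r N = {Y \<in> E \<rightarrow>\<^sub>E telems field_tract. \<forall>t\<in>nsets E (r + 1).
      formal_sum field_tract (\<lambda>i. tmult field_tract (circuit_vector field_tract E P t i) (\<sigma> (Y i))) E \<in> null_set field_tract}"
      by (rule tract.covectors_eq[OF tract_field_tract finite_E _ PN]) (use PE scaled in auto)
    then show ?thesis
      by (simp add: formal_sum_field_tract_null_iff[OF finite_E] circuit_vector_field_tract cong: sum.cong)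
  qed
  have covT: "covectors T \<tau> E r (pushforward T \<nu> E r N) = {Y \<in> E \<rightarrow>\<^sub>E telems T. \<forall>t\<in>nsets E (r + 1).
      formal_sum T (\<lambda>i. tmult T (\<nu> (circ ?\<beta> P t i)) (\<tau> (Y i))) E \<in> null_set T}"
  proof -
    have "covectors T \<tau> E r (pushforward T \<nu> E r N) = {Y \<in> E \<rightarrow>\<^sub>E telems T. \<forall>t\<in>nsets E (r + 1).
      formal_sum T (\<lambda>i. tmult T (circuit_vector T E \<nu>P t i) (\<tau> (Y i))) E \<in> null_set T}"
    proof (rule T.covectors_eq[OF finite_E \<nu>PE \<nu>P_in _ \<tau>_closed])
      fix Q assume "Q \<in> pushforward T \<nu> E r N"
      then obtain P' d where P': "P' \<in> N" "d \<in> carrier T"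
        "Q = (\<lambda>A\<in>nsets E r. tmult T d ((\<lambda>A\<in>nsets E r. \<nu> (P' A)) A))"
        unfolding pushforward_def scaling_rel_def by blast
      obtain c where c: "c \<noteq> 0" "\<And>A. A \<in> nsets E r \<Longrightarrow> P' A = c * P A" using scaled[OF P'(1)] by blast
      have "Q A = tmult T (tmult T d (\<nu> c)) (\<nu>P A)" if A: "A \<in> nsets E r" for A
      proof -
        have "\<nu> c \<in> telems T" "\<nu> (P A) \<in> telems T" using \<nu>_range by blast+
        then show ?thesis using A c(2)[OF A] T.tmult_assoc[OF T.carrier_telems[OF P'(2)]]
          by (simp add: P'(3) \<nu>P_def \<nu>_tmult)
      qed
      then show "\<exists>d\<in>carrier T. \<forall>A\<in>nsets E r. Q A = tmult T d (\<nu>P A)"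
        using T.tmult_carrier[OF P'(2) \<nu>_nonzero[OF c(1)]] by blast
    qed
    moreover have "formal_sum T (\<lambda>i. tmult T (circuit_vector T E \<nu>P t i) (\<tau> (Y i))) E
        = formal_sum T (\<lambda>i. tmult T (\<nu> (circ ?\<beta> P t i)) (\<tau> (Y i))) E" if "t \<in> nsets E (r + 1)" for t Y
      unfolding formal_sum_def \<nu>P_def
      by (intro arg_cong[where f = "filter_mset _"] image_mset_cong)
        (use finite_E circuit_vector_pushforward[OF lv that] in simp)
    ultimately show ?thesis by simp
  qed
  show ?thesis unfolding covN covT
  proof (intro equalityI subsetI)
    fix Z assume "Z \<in> (\<lambda>Y. \<lambda>i\<in>E. \<nu> (Y i)) ` {Y \<in> E \<rightarrow>\<^sub>E UNIV. \<forall>t\<in>nsets E (r + 1).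
      (\<Sum>i\<in>E. circ ?\<beta> P t i * \<sigma> (Y i)) = 0}"
    then obtain Y where Z: "Z = (\<lambda>i\<in>E. \<nu> (Y i))"
      and Y: "\<And>t. t \<in> nsets E (r + 1) \<Longrightarrow> (\<Sum>i\<in>E. circ ?\<beta> P t i * \<sigma> (Y i)) = 0" by blast
    have "formal_sum T (\<lambda>i. tmult T (\<nu> (circ ?\<beta> P t i)) (\<tau> (Z i))) E \<in> null_set T"
      if t: "t \<in> nsets E (r + 1)" for t
    proof -
      have "formal_sum T (\<lambda>i. tmult T (\<nu> (circ ?\<beta> P t i)) (\<tau> (Z i))) E
          = formal_sum T (\<lambda>i. \<nu> (circ ?\<beta> P t i * \<sigma> (Y i))) E"
        unfolding formal_sum_def
        by (intro arg_cong[where f = "filter_mset _"] image_mset_cong)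
          (use finite_E in \<open>simp add: Z \<nu>_tmult \<sigma>(2)\<close>)
      then show ?thesis using \<nu>_null[OF finite_E Y[OF t]] by simp
    qed
    moreover have "Z \<in> E \<rightarrow>\<^sub>E telems T" using \<nu>_range by (auto simp: Z)
    ultimately show "Z \<in> {Y \<in> E \<rightarrow>\<^sub>E telems T. \<forall>t\<in>nsets E (r + 1).
      formal_sum T (\<lambda>i. tmult T (\<nu> (circ ?\<beta> P t i)) (\<tau> (Y i))) E \<in> null_set T}" by blast
  next
    fix Z assume "Z \<in> {Y \<in> E \<rightarrow>\<^sub>E telems T. \<forall>t\<in>nsets E (r + 1).
      formal_sum T (\<lambda>i. tmult T (\<nu> (circ ?\<beta> P t i)) (\<tau> (Y i))) E \<in> null_set T}"
    then have ZE: "Z \<in> E \<rightarrow>\<^sub>E telems T" and Z: "\<And>t. t \<in> nsets E (r + 1) \<Longrightarrow>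
      formal_sum T (\<lambda>i. tmult T (\<nu> (circ ?\<beta> P t i)) (\<tau> (Z i))) E \<in> null_set T" by blast+
    have Zi: "Z i \<in> telems T" if "i \<in> E" for i using ZE that by blast
    define z where "z i = inv_into UNIV \<nu> (\<tau> (Z i))" for i
    have z: "\<nu> (z i) = \<tau> (Z i)" if "i \<in> E" for i
      unfolding z_def using \<tau>_closed[OF Zi[OF that]] \<nu>_range by (simp add: f_inv_into_f)
    note plucker = plucker_vector_signed_plucker[OF finite_E r P]
    have "\<exists>y. signed_plucker.covector E r ?\<beta> P y \<and> (\<forall>i\<in>E. \<nu> (y i) = \<nu> (z i))"
    proof (rule ex_covector_with_valuations[OF plucker])
      fix J assume J: "J \<subseteq> E" "card J = r + 1"
      then have "J \<in> nsets E (r + 1)" using finite_E finite_subset by (auto simp: nsets_def)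
      moreover have "formal_sum T (\<lambda>i. tmult T (\<nu> (circ ?\<beta> P J i)) (\<tau> (Z i))) E
          = formal_sum T (\<lambda>i. \<nu> (circ ?\<beta> P J i * z i)) E"
        unfolding formal_sum_def
        by (intro arg_cong[where f = "filter_mset _"] image_mset_cong)
          (use finite_E in \<open>simp add: z \<nu>_tmult\<close>)
      ultimately show "formal_sum T (\<lambda>i. \<nu> (circ ?\<beta> P J i * z i)) E \<in> null_set T" using Z[of J] by simp
    qed
    then obtain y where y: "signed_plucker.covector E r ?\<beta> P y" "\<And>i. i \<in> E \<Longrightarrow> \<nu> (y i) = \<tau> (Z i)"
      using z by auto
    \<comment> \<open>Since \<open>\<sigma>\<close> squares to the identity,
      \<open>\<sigma> (Y i)\<close> is \<open>y i\<close>, and \<open>\<nu> (Y i)\<close> is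
      \<open>\<tau> (\<tau> (Z i))\<close>, that is \<open>Z i\<close>.\<close>
    define Y where "Y = (\<lambda>i\<in>E. \<sigma> (y i))"
    have "(\<Sum>i\<in>E. circ ?\<beta> P t i * \<sigma> (Y i)) = 0" if "t \<in> nsets E (r + 1)" for t
    proof -
      have "(\<Sum>i\<in>E. circ ?\<beta> P t i * y i) = 0"
        using y(1) that unfolding signed_plucker.covector_def[OF plucker] nsets_def by blast
      then show ?thesis by (simp add: Y_def \<sigma>(1) cong: sum.cong)
    qed
    moreover have "Z = (\<lambda>i\<in>E. \<nu> (Y i))"
    proof
      fix i show "Z i = (\<lambda>i\<in>E. \<nu> (Y i)) i"
      proof (cases "i \<in> E")
        case True
        then have "\<nu> (Y i) = \<tau> (\<tau> (Z i))" by (simp only: Y_def restrict_apply' \<sigma>(2) y(2))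
        then show ?thesis using True by (simp only: restrict_apply' \<tau>[OF Zi])
      next
        case False
        then show ?thesis using PiE_arb[OF ZE] by simp
      qed
    qed
    moreover have "Y \<in> E \<rightarrow>\<^sub>E UNIV" by (simp add: Y_def)
    ultimately show "Z \<in> (\<lambda>Y. \<lambda>i\<in>E. \<nu> (Y i)) ` {Y \<in> E \<rightarrow>\<^sub>E UNIV. \<forall>t\<in>nsets E (r + 1).
      (\<Sum>i\<in>E. circ ?\<beta> P t i * \<sigma> (Y i)) = 0}" by blast
  qed
qed

section \<open>The three valuations\<close>

text \<open>Over a field the null condition says literally that the all-ones tuple is orthogonal to
  the circuits, so it is its own lift.\<close>

lemma liftable_valuation_fval:
  assumes "finite E"
  shows "liftable_valuation field_tract (\<lambda>a. a) (fval :: ('f::field, 'g::linordered_ab_group_add) hahn \<Rightarrow> _) E"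
proof (rule liftable_valuation.intro[OF tract_field_tract enriched_valuation_fval])
  fix S r \<alpha> \<beta> and P :: "'a set \<Rightarrow> 'f"
  assume plucker: "signed_plucker S r \<alpha> \<beta> P"
    and null: "\<And>J. J \<subseteq> S \<Longrightarrow> card J = r + 1 \<Longrightarrow> formal_sum field_tract (circ \<beta> P J) S \<in> null_set field_tract"
  interpret signed_plucker S r \<alpha> \<beta> P by fact
  have "covector (\<lambda>_. 1)"
    using null finite_ground by (simp add: covector_def formal_sum_field_tract_null_iff)
  then show "\<exists>a. covector a \<and> (\<forall>i\<in>S. a i = \<one>\<^bsub>field_tract\<^esub>)"
    by (intro exI[of _ "\<lambda>_. 1"]) simp
qed (simp_all add: fval_def assms)

text \<open>A sum over the Krasner hyperfield is null unless it has exactly one term, so the null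
  condition says that no circuit has a support of one element.\<close>

lemma liftable_valuation_val:
  assumes "finite E" and inf: "infinite (UNIV :: 'f set)"
  shows "liftable_valuation krasner (\<lambda>a. if a = 0 then 0 else 1)
    (val :: ('f::field, 'g::linordered_ab_group_add) hahn \<Rightarrow> _) E"
proof (rule liftable_valuation.intro[OF tract_krasner enriched_valuation_val])
  fix S r \<alpha> \<beta> and P :: "'a set \<Rightarrow> 'f"
  assume plucker: "signed_plucker S r \<alpha> \<beta> P"
    and null: "\<And>J. J \<subseteq> S \<Longrightarrow> card J = r + 1 \<Longrightarrow>
      formal_sum krasner (\<lambda>i. if circ \<beta> P J i = 0 then 0 else 1) S \<in> null_set krasner"
  interpret signed_plucker S r \<alpha> \<beta> P by fact
  have "card {i \<in> S. circ \<beta> P J i \<noteq> 0} \<noteq> 1" if "J \<subseteq> S" "card J = r + 1" for J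
  proof -
    have "{i \<in> S. (if circ \<beta> P J i = 0 then 0 else 1) \<noteq> tzero krasner} = {i \<in> S. circ \<beta> P J i \<noteq> 0}"
      by (auto simp: krasner_def)
    then have "size (formal_sum krasner (\<lambda>i. if circ \<beta> P J i = 0 then 0 else 1) S) = card {i \<in> S. circ \<beta> P J i \<noteq> 0}"
      unfolding formal_sum_eq_image_mset[OF finite_ground] by simp
    then show ?thesis using null[OF that] by (simp add: null_set_krasner)
  qed
  then obtain a where "covector a" "\<forall>i\<in>S. a i \<noteq> 0" using ex_covector_nowhere_zero[OF inf] by blast
  then show "\<exists>a. covector a \<and> (\<forall>i\<in>S. (if a i = 0 then 0 else 1) = \<one>\<^bsub>krasner\<^esub>)"
    by (intro exI[of _ a]) (simp add: krasner_def)
qed (simp_all add: val_def krasner_def leading_coeff_nonzero assms)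

text \<open>A nonempty null sum of signs contains both signs, so every nonzero circuit has entries
  of both signs, as \<open>ex_positive_covector\<close> requires.\<close>

lemma liftable_valuation_sval:
  assumes "finite E"
  shows "liftable_valuation sign_hyperfield (\<lambda>a. if a = 0 then 0 else if a > 0 then 1 else - 1)
    (sval :: ('f::linordered_field, 'g::linordered_ab_group_add) hahn \<Rightarrow> _) E"
proof (rule liftable_valuation.intro[OF tract_sign_hyperfield enriched_valuation_sval])
  let ?sgn = "\<lambda>a :: 'f. if a = 0 then 0 else if a > 0 then 1 else - 1 :: int"
  fix S r \<alpha> \<beta> and P :: "'a set \<Rightarrow> 'f"
  assume plucker: "signed_plucker S r \<alpha> \<beta> P"
    and null: "\<And>J. J \<subseteq> S \<Longrightarrow> card J = r + 1 \<Longrightarrow>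
      formal_sum sign_hyperfield (\<lambda>i. ?sgn (circ \<beta> P J i)) S \<in> null_set sign_hyperfield"
  interpret signed_plucker S r \<alpha> \<beta> P by fact
  have "(\<exists>i\<in>S. circ \<beta> P J i > 0) \<and> (\<exists>i\<in>S. circ \<beta> P J i < 0)"
    if J: "J \<subseteq> S" "card J = r + 1" and nz: "\<exists>i\<in>S. circ \<beta> P J i \<noteq> 0" for J
  proof -
    let ?M = "formal_sum sign_hyperfield (\<lambda>i. ?sgn (circ \<beta> P J i)) S"
    have "tzero sign_hyperfield = 0" by (simp add: sign_hyperfield_def)
    then have M: "set_mset ?M = {?sgn (circ \<beta> P J i) |i. i \<in> S \<and> circ \<beta> P J i \<noteq> 0}"
      using finite_ground by (auto simp: formal_sum_eq_image_mset)
    then have "?M \<noteq> {#}" using nz by force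
    then have "1 \<in># ?M" "- 1 \<in># ?M" using null[OF J] unfolding null_set_sign_hyperfield by blast+
    then obtain i j where "i \<in> S" "?sgn (circ \<beta> P J i) = 1" "j \<in> S" "circ \<beta> P J j \<noteq> 0" "?sgn (circ \<beta> P J j) = - 1"
      unfolding M by force
    then have "circ \<beta> P J i > 0" "circ \<beta> P J j < 0" by (simp_all add: not_less split: if_splits)
    then show ?thesis using \<open>i \<in> S\<close> \<open>j \<in> S\<close> by blast
  qed
  then obtain a where "covector a" "\<forall>i\<in>S. a i > 0" using ex_positive_covector[OF plucker] by blast
  then show "\<exists>a. covector a \<and> (\<forall>i\<in>S. ?sgn (a i) = \<one>\<^bsub>sign_hyperfield\<^esub>)"
    by (intro exI[of _ a]) (auto simp: sign_hyperfield_def)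
qed (simp_all add: sval_def sign_hyperfield_def leading_coeff_nonzero assms)

theorem proposition5p12:
  fixes E :: "'e::linorder set" and r :: nat
  assumes "finite E" and "1 \<le> r" and "r \<le> card E"
  shows
    "(\<forall>(N :: ('e set \<Rightarrow> ('f::field, 'g::linordered_ab_group_add) hahn) set) \<sigma> \<tau>.
        infinite (UNIV :: 'f set) \<longrightarrow>
        N \<in> matroids field_tract E r \<longrightarrow>
        compatible_involutions field_tract (tropical_extension krasner) val \<sigma> \<tau> \<longrightarrow>
        (\<lambda>Y. \<lambda>i\<in>E. val (Y i)) ` covectors field_tract \<sigma> E r N =
          covectors (tropical_extension krasner) \<tau> E r
            (pushforward (tropical_extension krasner) val E r N)) \<and>
     (\<forall>(N :: ('e set \<Rightarrow> ('o::linordered_field, 'g) hahn) set) \<sigma> \<tau>.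
        infinite (UNIV :: 'o set) \<longrightarrow>
        N \<in> matroids field_tract E r \<longrightarrow>
        compatible_involutions field_tract (tropical_extension sign_hyperfield) sval \<sigma> \<tau> \<longrightarrow>
        (\<lambda>Y. \<lambda>i\<in>E. sval (Y i)) ` covectors field_tract \<sigma> E r N =
          covectors (tropical_extension sign_hyperfield) \<tau> E r
            (pushforward (tropical_extension sign_hyperfield) sval E r N)) \<and>
     (\<forall>(N :: ('e set \<Rightarrow> ('f, 'g) hahn) set) \<sigma> \<tau>.
        infinite (UNIV :: 'f set) \<longrightarrow>
        N \<in> matroids field_tract E r \<longrightarrow>
        compatible_involutions field_tract (tropical_extension field_tract) fval \<sigma> \<tau> \<longrightarrow>
        (\<lambda>Y. \<lambda>i\<in>E. fval (Y i)) ` covectors field_tract \<sigma> E r N =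
          covectors (tropical_extension field_tract) \<tau> E r
            (pushforward (tropical_extension field_tract) fval E r N))"
  by (intro conjI allI impI;
      rule valuation_covectors[OF liftable_valuation_val[OF \<open>finite E\<close>] \<open>1 \<le> r\<close>]
        valuation_covectors[OF liftable_valuation_sval[OF \<open>finite E\<close>] \<open>1 \<le> r\<close>]
        valuation_covectors[OF liftable_valuation_fval[OF \<open>finite E\<close>] \<open>1 \<le> r\<close>];
      assumption)

end
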